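(* For each $n\in\omega$ let $$D_n=\{(x,y)\in{}^2({}^\omega2):(\exists i<j)(n\le i<j\wedge\delta_i^j(x,y)>3\wedge(\forall m)(i\le m<j\Rightarrow x(m)\neq y(m)))\}.$$ Each $D_n$ is dense open in ${}^2({}^\omega2)$, so $C=\bigcap_{n\in\omega}D_n$ is comeager. Suppose $z\in{}^\omega2$, $X_0,X_1\subseteq{}^\omega2$ are $\Sigma^1_1(z)$, and $(m_k:k\in\omega)$ is strictly increasing and $g^0,g^1:{}^{<\omega}2\to{}^{<\omega}2$ satisfy, for all $i,j<2$: (1) if $|s|=k$ then $g^i(s)\in{}^{m_k}2$; (2) if $s\subseteq t$ then $g^i(s)\subseteq g^i(t)$; (3) if $|s|=|t|=k>0$ and $s(k-1)=t(k-1)$ then $\delta_{m_{k-1}}^{m_k}(g^i(s),g^i(t))<2^{-(k+1)}$; (4) if $|s|=|t|=k>0$ and $s(k-1)\neq t(k-1)$ then $|\delta_{m_{k-1}}^{m_k}(g^i(s),g^i(t))-\frac1k|<2^{-(k+1)}$; (5) for $s\in{}^k2$, $k>0$, $\delta_{m_{k-1}}^{m_k}(g^i(s),g^j(s))<2^{-(k+1)}$; (6) with $\Phi^i(x)=\bigcup_n g^i(x\upharpoonright n)$, $\Phi^i:{}^\omega2\to X_i\cap H_z$ witnesses $E_2\le_{\Delta^1_1}E_2\upharpoonright(X_i\cap H_z)$ and $[\Phi^0[{}^\omega2]]_{E_2}=[\Phi^1[{}^\omega2]]_{E_2}$. Then $(\Phi^0(\tilde0),\Phi^1(\widetilde{01}))\notin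 C$. Furthermore, for any $\Delta^1_1$ sets $B_0,B_1\subseteq{}^\omega2$ with $E_2\le_{\Delta^1_1}E_2\upharpoonright B_0$, $E_2\le_{\Delta^1_1}E_2\upharpoonright B_1$ and $[B_0]_{E_2}=[B_1]_{E_2}$, we have $B_0\times_{E_2}B_1\not\subseteq C$. Consequently $E_2$ does not have the weak $2$-Mycielski property.
   Context: For $x,y\in{}^N2$ and $m<n\le N\le\omega$, $\delta_m^n(x,y)=\sum\{\frac1{k+1}:m\le k<n,\ x(k)\neq y(k)\}$, $\delta=\delta_0^\omega$. $E_2$: $x\,E_2\,y$ iff $\delta(x,y)<\infty$; $[A]_{E_2}$ is the saturation. $\tilde0$ is the constant $0$ sequence, $\widetilde{01}=0101\dots$. For rational $q>0$, $A\subseteq{}^\omega2$, $a\in A$: the $q$-galaxy of $a$ in $A$ is the set of $b\in A$ reachable from $a$ by a finite chain in $A$ with consecutive $\delta$-distances $<q$; $A$ is $q$-grainy iff $\delta(a,b)<1$ for all $a\in A$ and $b$ in its $q$-galaxy; grainy iff $q$-grainy for some $q$. $H_z={}^\omega2\setminus S_z$, where $S_z$ is the union of all $\Delta^1_1(z)$ grainy sets. $B_0\times_{E_2}B_1=\{(x,y):x\in B_0,y\in B_1,\neg(x\,E_2\,y)\}$. $E\le_{\Delta^1_1}F$ means a $\Delta^1_1$ reduction exists; $\equiv_{\Delta^1_1}$ means both directions. $E$ on a Polish space $X$ has the weak $n$-Mycielski property iff for every comeager $C\subseteq{}^nX$ there are $\Delta^1_1$ sets $A_i$ ($i<n$) with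 $E\equiv_{\Delta^1_1}E\upharpoonright A_i$ and $\{(x_0,\dots,x_{n-1}):x_i\in A_i,\ \neg(x_i\,E\,x_j)\ (i\neq j)\}\subseteq C$.
   Formalization: The weak n-Mycielski property is amended to also require that the sets A_i all have the same E-saturation; without this clause E_2 does have the weak 2-Mycielski property, so the last sentence would be false. *)

theory Defs
  imports "HOL-Analysis.Analysis" "HOL-Library.Sublist" "HOL-Library.Extended_Real"
begin

section \<open>The equivalence relation E2\<close>

text \<open>
  Points of Cantor space are functions \<open>nat \<Rightarrow> bool\<close> (with the product topology), the digits 0 and 1
  being \<open>False\<close> and \<open>True\<close>; finite binary strings are elements of \<open>bool list\<close>.
\<close>

type_synonym cantor = "nat \<Rightarrow> bool"

text \<open>For finite strings \<open>s\<close>, \<open>t\<close> of length at least \<open>n\<close>, the distance is \<open>delta m n (nth s) (nth t)\<close>.\<close>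

definition delta :: "nat \<Rightarrow> enat \<Rightarrow> cantor \<Rightarrow> cantor \<Rightarrow> ereal" where
  "delta m n x y =
     (\<Sum>k. if m \<le> k \<and> enat k < n \<and> x k \<noteq> y k then ereal (1 / (real k + 1)) else 0)"

definition E2 :: "cantor \<Rightarrow> cantor \<Rightarrow> bool" where
  "E2 x y \<longleftrightarrow> delta 0 \<infinity> x y < \<infinity>"

definition saturation :: "('a \<Rightarrow> 'a \<Rightarrow> bool) \<Rightarrow> 'a set \<Rightarrow> 'a set" where
  "saturation E A = {y. \<exists>x\<in>A. E x y}"

definition prod_E2 :: "cantor set \<Rightarrow> cantor set \<Rightarrow> (cantor \<times> cantor) set" where
  "prod_E2 B0 B1 = {(x, y). x \<in> B0 \<and> y \<in> B1 \<and> \<not> E2 x y}"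

definition galaxy :: "rat \<Rightarrow> cantor set \<Rightarrow> cantor \<Rightarrow> cantor set" where
  "galaxy q A a =
     {b \<in> A. (\<lambda>u v. u \<in> A \<and> v \<in> A \<and> delta 0 \<infinity> u v < ereal (of_rat q))\<^sup>*\<^sup>* a b}"

definition grainy :: "cantor set \<Rightarrow> bool" where
  "grainy A \<longleftrightarrow> (\<exists>q>0. \<forall>a\<in>A. \<forall>b\<in>galaxy q A a. delta 0 \<infinity> a b < 1)"


section \<open>The lightface pointclasses, relative to a parameter\<close>

text \<open>
  \<open>\<Sigma>\<^sup>1\<^sub>1(z)\<close> is definability over second-order arithmetic by an arithmetical formula preceded by
  one existential function quantifier, with \<open>z\<close> as a parameter. In \<open>arith_term\<close> and
  \<open>arith_formula\<close>, number variables are de Bruijn indices, and \<open>App i t\<close> applies the \<open>i\<close>-th function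
  variable; these are never quantified inside a formula.
\<close>

datatype arith_term =
  Var nat | Zero | Succ arith_term | Plus arith_term arith_term | Times arith_term arith_term
| App nat arith_term

datatype arith_formula =
  Eq arith_term arith_term | Neg arith_formula | Conj arith_formula arith_formula
| Exists arith_formula

primrec term_val :: "(nat \<Rightarrow> nat \<Rightarrow> nat) \<Rightarrow> (nat \<Rightarrow> nat) \<Rightarrow> arith_term \<Rightarrow> nat" where
  "term_val F e (Var v) = e v"
| "term_val F e Zero = 0"
| "term_val F e (Succ t) = Suc (term_val F e t)"
| "term_val F e (Plus t u) = term_val F e t + term_val F e u"
| "term_val F e (Times t u) = term_val F e t * term_val F e u"
| "term_val F e (App i t) = F i (term_val F e t)"

primrec holds :: "(nat \<Rightarrow> nat \<Rightarrow> nat) \<Rightarrow> (nat \<Rightarrow> nat) \<Rightarrow> arith_formula \<Rightarrow> bool" where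
  "holds F e (Eq t u) \<longleftrightarrow> term_val F e t = term_val F e u"
| "holds F e (Neg p) \<longleftrightarrow> \<not> holds F e p"
| "holds F e (Conj p q) \<longleftrightarrow> holds F e p \<and> holds F e q"
| "holds F e (Exists p) \<longleftrightarrow> (\<exists>n. holds F (case_nat n e) p)"

text \<open>
  Function variables 0, 1, 2 stand for the parameter \<open>z\<close>, the point \<open>x\<close> and the witness \<open>f\<close>.
\<close>

definition lightface_Sigma11 :: "cantor \<Rightarrow> cantor set \<Rightarrow> bool" where
  "lightface_Sigma11 z A \<longleftrightarrow>
     (\<exists>p. \<forall>x. x \<in> A \<longleftrightarrow>
        (\<exists>f :: nat \<Rightarrow> nat.
           holds (\<lambda>i. if i = 0 then (\<lambda>k. of_bool (z k))
                      else if i = 1 then (\<lambda>k. of_bool (x k)) else f) (\<lambda>_. 0) p))"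

definition lightface_Delta11 :: "cantor \<Rightarrow> cantor set \<Rightarrow> bool" where
  "lightface_Delta11 z A \<longleftrightarrow> lightface_Sigma11 z A \<and> lightface_Sigma11 z (- A)"

definition S :: "cantor \<Rightarrow> cantor set" where
  "S z = \<Union>{A. lightface_Delta11 z A \<and> grainy A}"

definition H :: "cantor \<Rightarrow> cantor set" where
  "H z = - S z"


section \<open>The boldface pointclasses, reductions and the weak Mycielski property\<close>

text \<open>
  Unlike \<open>\<Delta>\<^sup>1\<^sub>1(z)\<close> in the definition of \<open>S z\<close>, the unrelativized \<open>\<Delta>\<^sup>1\<^sub>1\<close> of reductions and of
  the weak Mycielski property is boldface.
\<close>

definition Sigma11 :: "'a::topological_space set \<Rightarrow> bool" where
  "Sigma11 A \<longleftrightarrow> (\<exists>K :: ('a \<times> (nat \<Rightarrow> nat)) set. closed K \<and> A = fst ` K)"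

definition Delta11 :: "'a::topological_space set \<Rightarrow> bool" where
  "Delta11 A \<longleftrightarrow> Sigma11 A \<and> Sigma11 (- A)"

definition Delta11_on :: "'a::topological_space set \<Rightarrow> ('a \<Rightarrow> 'b::topological_space) \<Rightarrow> bool" where
  "Delta11_on A f \<longleftrightarrow> (\<forall>U. open U \<longrightarrow> (\<exists>D. Delta11 D \<and> f -` U \<inter> A = D \<inter> A))"

text \<open>
  \<open>is_reduction E A F B f\<close>: \<open>f\<close> witnesses that the restriction of \<open>E\<close> to \<open>A\<close> is \<open>\<Delta>\<^sup>1\<^sub>1\<close>
  reducible to the restriction of \<open>F\<close> to \<open>B\<close>.
\<close>

definition is_reduction ::
  "('a::topological_space \<Rightarrow> 'a \<Rightarrow> bool) \<Rightarrow> 'a set \<Rightarrow>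
   ('b::topological_space \<Rightarrow> 'b \<Rightarrow> bool) \<Rightarrow> 'b set \<Rightarrow> ('a \<Rightarrow> 'b) \<Rightarrow> bool" where
  "is_reduction E A F B f \<longleftrightarrow>
     f ` A \<subseteq> B \<and> Delta11_on A f \<and> (\<forall>x\<in>A. \<forall>y\<in>A. E x y \<longleftrightarrow> F (f x) (f y))"

definition reducible ::
  "('a::topological_space \<Rightarrow> 'a \<Rightarrow> bool) \<Rightarrow> 'a set \<Rightarrow>
   ('b::topological_space \<Rightarrow> 'b \<Rightarrow> bool) \<Rightarrow> 'b set \<Rightarrow> bool" where
  "reducible E A F B \<longleftrightarrow> (\<exists>f. is_reduction E A F B f)"

definition bireducible ::
  "('a::topological_space \<Rightarrow> 'a \<Rightarrow> bool) \<Rightarrow> 'a set \<Rightarrow>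
   ('b::topological_space \<Rightarrow> 'b \<Rightarrow> bool) \<Rightarrow> 'b set \<Rightarrow> bool" where
  "bireducible E A F B \<longleftrightarrow> reducible E A F B \<and> reducible F B E A"

definition comeager_in :: "'a topology \<Rightarrow> 'a set \<Rightarrow> bool" where
  "comeager_in T C \<longleftrightarrow> C \<subseteq> topspace T \<and>
     (\<exists>U :: nat \<Rightarrow> 'a set. (\<forall>n. openin T (U n) \<and> T closure_of U n = topspace T) \<and> (\<Inter>n. U n) \<subseteq> C)"

text \<open>
  An \<open>n\<close>-tuple is an extensional function on \<open>{..<n}\<close>. The sets \<open>A i\<close> are required to have a
  common saturation. Without this requirement the property would be trivial for E2: given a comeager
  set of pairs, one could prescribe digits of the points of \<open>A 0\<close> and of \<open>A 1\<close> on sparse blocks so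
  that the whole of \<open>A 0 \<times> A 1\<close> lies in it, while the remaining digits still carry a copy of E2.
\<close>

definition weak_mycielski :: "nat \<Rightarrow> ('a::topological_space \<Rightarrow> 'a \<Rightarrow> bool) \<Rightarrow> bool" where
  "weak_mycielski n E \<longleftrightarrow>
     (\<forall>C. comeager_in (product_topology (\<lambda>_. euclidean) {..<n}) C \<longrightarrow>
       (\<exists>A :: nat \<Rightarrow> 'a set.
          (\<forall>i<n. Delta11 (A i) \<and> bireducible E UNIV E (A i)) \<and>
          (\<forall>i<n. \<forall>j<n. saturation E (A i) = saturation E (A j)) \<and>
          {x \<in> (\<Pi>\<^sub>E i\<in>{..<n}. A i). \<forall>i<n. \<forall>j<n. i \<noteq> j \<longrightarrow> \<not> E (x i) (x j)} \<subseteq> C))"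


section \<open>The comeager set and the maps between Cantor spaces\<close>

definition D :: "nat \<Rightarrow> (cantor \<times> cantor) set" where
  "D n = {(x, y). \<exists>i j :: nat. n \<le> i \<and> i < j \<and> delta i j x y > 3 \<and> (\<forall>m. i \<le> m \<and> m < j \<longrightarrow> x m \<noteq> y m)}"

definition C :: "(cantor \<times> cantor) set" where
  "C = (\<Inter>n. D n)"

definition restr :: "cantor \<Rightarrow> nat \<Rightarrow> bool list" where
  "restr x n = map x [0..<n]"

text \<open>
  \<open>Phi h x\<close> is the union of the strings \<open>h (restr x n)\<close>; it is a total function
  when \<open>h\<close> is monotone for \<open>prefix\<close> and these strings have unbounded lengths.
\<close>

definition Phi :: "(bool list \<Rightarrow> bool list) \<Rightarrow> cantor \<Rightarrow> cantor" where
  "Phi h x k = (THE b. \<exists>n. k < length (h (restr x n)) \<and> b = h (restr x n) ! k)"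

end

theory Submission
  imports Defs "HOL-Analysis.Harmonic_Numbers"
begin

text \<open>
  Let \<open>f\<close> reduce \<open>E2\<close> to its restriction to \<open>B0\<close>. On a comeager set \<open>f\<close> is continuous, and there
  changes of small weight in the argument cause only small changes in a tail of the value. Since
  the values at inequivalent points are infinitely far apart, a chain of one-digit changes can be stopped
  when the value has moved by a distance of about 1. Infinitely many such moves, separated by heavy
  intervals on which the values nearly agree, are fused into points \<open>x\<close>, \<open>x'\<close> such that \<open>f x\<close> and \<open>f x'\<close>
  are inequivalent but have distance at most 2 on any interval where they disagree almost everywhere.
  If \<open>y \<in> B1\<close> is equivalent to \<open>f x'\<close>, then far out no interval of total disagreement between \<open>f x\<close> and
  \<open>y\<close> has weight above 3, so \<open>(f x, y)\<close> is outside \<open>C\<close>.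
\<close>

section \<open>Distances on intervals\<close>

text \<open>Two demands pull against each other: the values at \<open>x\<close> and
  \<open>x'\<close> must be infinitely far apart, yet no heavy interval may consist of disagreements
  only. Distances between values of a reduction cannot be prescribed; a move can only be stopped in
  time. This is possible because a single digit \<open>k\<close> weighs only
  \<open>1 / (k + 1)\<close>, so late one-digit flips move the value little, whereas flipping all
  digits from some place on gives an inequivalent point and hence moves of any size. The obstacle in
  the fusion is that flips made at earlier stages persist. Their effect beyond the current place
  must be small uniformly on a whole cylinder, not just at one point, and this uniformity is what
  Baire category supplies. The constant 3 leaves room: a run of total disagreement between
  \<open>f x\<close> and \<open>y\<close> costs at most 13/10 for one move, 1/10 for the next buffer
  and 1/10 for replacing \<open>f x'\<close> by \<open>y\<close>. Since \<open>y\<close> enters only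
  through this last error, it can be any point equivalent to \<open>f x'\<close>, which is all that
  equality of saturations offers.\<close>

definition ds :: "nat \<Rightarrow> nat \<Rightarrow> cantor \<Rightarrow> cantor \<Rightarrow> real" where
  "ds a b x y = (\<Sum>k=a..<b. if x k \<noteq> y k then 1 / (real k + 1) else 0)"

definition weight :: "nat \<Rightarrow> nat \<Rightarrow> real" where
  "weight a b = (\<Sum>k=a..<b. 1 / (real k + 1))"

lemma delta_eq_ds: "delta a (enat b) x y = ereal (ds a b x y)"
proof -
  have "delta a (enat b) x y = (\<Sum>k\<in>{a..<b}. if a \<le> k \<and> enat k < enat b \<and> x k \<noteq> y k then ereal (1 / (real k + 1)) else 0)"
    unfolding delta_def by (rule suminf_finite) auto
  also have "\<dots> = (\<Sum>k\<in>{a..<b}. ereal (if x k \<noteq> y k then 1 / (real k + 1) else 0))"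
    by (rule sum.cong) (auto simp: zero_ereal_def)
  finally show ?thesis by (simp add: ds_def)
qed

lemma ds_nonneg: "0 \<le> ds a b x y"
  unfolding ds_def by (rule sum_nonneg) auto

lemma ds_le_weight: "ds a b x y \<le> weight a b"
  unfolding ds_def weight_def by (rule sum_mono) auto

lemma ds_refl [simp]: "ds a b x x = 0"
  by (simp add: ds_def)

lemma ds_commute: "ds a b x y = ds a b y x"
  unfolding ds_def by (rule sum.cong) auto

lemma ds_triangle: "ds a b x z \<le> ds a b x y + ds a b y z"
  unfolding ds_def sum.distrib[symmetric] by (rule sum_mono) auto

lemma ds_cong:
  assumes "\<And>k. a \<le> k \<Longrightarrow> k < b \<Longrightarrow> x k = x' k" "\<And>k. a \<le> k \<Longrightarrow> k < b \<Longrightarrow> y k = y' k"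
  shows "ds a b x y = ds a b x' y'"
  unfolding ds_def by (rule sum.cong) (auto simp: assms)

lemma ds_split: "a \<le> b \<Longrightarrow> b \<le> c \<Longrightarrow> ds a c x y = ds a b x y + ds b c x y"
  unfolding ds_def by (rule sum.atLeastLessThan_concat[symmetric])

lemma weight_split: "a \<le> b \<Longrightarrow> b \<le> c \<Longrightarrow> weight a c = weight a b + weight b c"
  unfolding weight_def by (rule sum.atLeastLessThan_concat[symmetric])

lemma ds_mono: "a' \<le> a \<Longrightarrow> b \<le> b' \<Longrightarrow> ds a b x y \<le> ds a' b' x y"
  unfolding ds_def by (rule sum_mono2) auto

lemma ds_eq_weight: "(\<And>k. a \<le> k \<Longrightarrow> k < b \<Longrightarrow> x k \<noteq> y k) \<Longrightarrow> ds a b x y = weight a b"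
  unfolding ds_def weight_def by (rule sum.cong) auto

text \<open>Where \<open>y\<close> disagrees with \<open>a\<close> everywhere, \<open>y\<close> is
  the complement of \<open>a\<close>. So if \<open>y\<close> is close to a third point
  \<open>b\<close>, then \<open>a\<close> and \<open>b\<close> disagree on almost all of the
  weight.\<close>

lemma ds_flip_left: "ds a b (\<lambda>k. \<not> x k) y = weight a b - ds a b x y"
  unfolding ds_def weight_def sum_subtractf[symmetric] by (rule sum.cong) auto

lemma weight_unbounded: "\<exists>b>a. L < weight a b"
proof -
  have *: "weight 0 n = harm n" for n
    by (induction n) (auto simp: weight_def harm_def field_simps)
  have "\<forall>\<^sub>F n in sequentially. (harm n :: real) > L + weight 0 a"
    using harm_at_top by (simp add: filterlim_at_top_dense)
  then obtain n where n: "n > a" "(harm n :: real) > L + weight 0 a"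
    using eventually_happens'[OF sequentially_bot eventually_conj[OF _ eventually_gt_at_top[of a]]] by blast
  then have "weight 0 n = weight 0 a + weight a n" by (intro weight_split) auto
  then show ?thesis using n * by (intro exI[of _ n]) auto
qed

section \<open>\<open>E2\<close> in terms of bounded real partial sums and tails\<close>

lemma E2_iff_ds: "E2 x y \<longleftrightarrow> (\<exists>B. \<forall>n. ds 0 n x y \<le> B)"
proof -
  let ?f = "\<lambda>k. if x k \<noteq> y k then ereal (1 / (real k + 1)) else 0"
  have "(\<Sum>k<n. ?f k) = ereal (ds 0 n x y)" for n
  proof -
    have "(\<Sum>k<n. ?f k) = (\<Sum>k=0..<n. ereal (if x k \<noteq> y k then 1 / (real k + 1) else 0))"
      by (rule sum.cong) (auto simp: zero_ereal_def)
    then show ?thesis by (simp add: ds_def)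
  qed
  then have eq: "delta 0 \<infinity> x y = (SUP n. ereal (ds 0 n x y))"
    unfolding delta_def by (subst suminf_ereal_eq_SUP) auto
  show ?thesis
  proof
    assume "E2 x y"
    then have lt: "(SUP n. ereal (ds 0 n x y)) < \<infinity>" unfolding E2_def eq .
    have "ereal (ds 0 0 x y) \<le> (SUP n. ereal (ds 0 n x y))" by (rule SUP_upper) simp
    with lt obtain r where r: "(SUP n. ereal (ds 0 n x y)) = ereal r"
      by (cases "SUP n. ereal (ds 0 n x y)") auto
    have "ds 0 n x y \<le> r" for n
    proof -
      have "ereal (ds 0 n x y) \<le> (SUP n. ereal (ds 0 n x y))" by (rule SUP_upper) simp
      then show ?thesis by (simp add: r)
    qed
    then show "\<exists>B. \<forall>n. ds 0 n x y \<le> B" by blast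
  next
    assume "\<exists>B. \<forall>n. ds 0 n x y \<le> B"
    then obtain B where "\<And>n. ds 0 n x y \<le> B" by blast
    then have "(SUP n. ereal (ds 0 n x y)) \<le> ereal B" by (intro SUP_least) simp
    also have "\<dots> < \<infinity>" by simp
    finally show "E2 x y" unfolding E2_def eq .
  qed
qed

lemma E2_sym: "E2 x y \<Longrightarrow> E2 y x"
  by (simp add: E2_iff_ds ds_commute)

lemma E2_trans:
  assumes "E2 x y" "E2 y z" shows "E2 x z"
proof -
  obtain A B where "\<And>n. ds 0 n x y \<le> A" "\<And>n. ds 0 n y z \<le> B" using assms by (auto simp: E2_iff_ds)
  then have "ds 0 n x z \<le> A + B" for n using ds_triangle[of 0 n x z y] by (meson add_mono order_trans)
  then show ?thesis by (auto simp: E2_iff_ds)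
qed

lemma E2_tail:
  assumes "E2 x y" "0 < e" shows "\<exists>M. \<forall>n. ds M n x y \<le> e"
proof -
  obtain B where B: "\<And>n. ds 0 n x y \<le> B" using assms by (auto simp: E2_iff_ds)
  let ?S = "range (\<lambda>n. ds 0 n x y)"
  have bdd: "bdd_above ?S" using B by (auto intro!: bdd_aboveI2)
  have "Sup ?S - e < Sup ?S" using assms by simp
  then obtain M where M: "Sup ?S - e < ds 0 M x y" by (subst (asm) less_cSup_iff[OF _ bdd]) auto
  have "ds M n x y \<le> e" for n
  proof (cases "M \<le> n")
    case True
    then have "ds 0 M x y + ds M n x y \<le> Sup ?S"
      using ds_split[of 0 M n x y] bdd by (metis cSup_upper le0 rangeI)
    then show ?thesis using M by simp
  next
    case False then show ?thesis using assms by (simp add: ds_def)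
  qed
  then show ?thesis by blast
qed

lemma not_E2_tail_unbounded:
  assumes "\<not> E2 x y" shows "\<exists>n>M. L < ds M n x y"
proof -
  \<comment> \<open>\<open>weight 0 M\<close> absorbs whatever the digits below \<open>M\<close>
    contribute; \<open>max 0 L\<close> makes \<open>M < n\<close> follow for negative
    \<open>L\<close> as well.\<close>
  obtain n where n: "max 0 L + weight 0 M < ds 0 n x y" using assms by (auto simp: E2_iff_ds not_le)
  have "M < n"
  proof (rule ccontr)
    assume "\<not> M < n"
    then have "ds 0 n x y \<le> ds 0 M x y" by (intro ds_mono) auto
    then show False using n ds_le_weight[of 0 M x y] by simp
  qed
  then have "ds 0 n x y = ds 0 M x y + ds M n x y" by (intro ds_split) auto
  then show ?thesis using n ds_le_weight[of 0 M x y] \<open>M < n\<close> by (intro exI[of _ n]) auto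
qed

lemma not_E2_if_blocks:
  assumes M: "strict_mono (M :: nat \<Rightarrow> nat)" and c: "0 < c" "\<And>k. c \<le> ds (M k) (M (Suc k)) x y"
  shows "\<not> E2 x y"
proof
  assume "E2 x y"
  then obtain B where B: "\<And>n. ds 0 n x y \<le> B" by (auto simp: E2_iff_ds)
  have "real k * c \<le> ds 0 (M k) x y" for k
  proof (induction k)
    case 0 show ?case by (simp add: ds_nonneg)
  next
    case (Suc k)
    have "ds 0 (M (Suc k)) x y = ds 0 (M k) x y + ds (M k) (M (Suc k)) x y"
      using M by (intro ds_split) (auto simp: strict_mono_less_eq)
    then show ?case using Suc c(2)[of k] by (simp add: algebra_simps)
  qed
  moreover obtain k where "real k * c > B" using reals_Archimedean3[OF c(1)] by blast
  ultimately show False using B[of "M k"] by (meson not_le order_trans)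
qed

section \<open>Cylinders\<close>

definition cyl :: "(nat \<Rightarrow> 'a) \<Rightarrow> nat \<Rightarrow> (nat \<Rightarrow> 'a) set" where
  "cyl x n = {y. \<forall>i<n. y i = x i}"

lemma cyl_self [simp]: "x \<in> cyl x n" by (simp add: cyl_def)

lemma cyl_eq: "y \<in> cyl x n \<Longrightarrow> cyl y n = cyl x n" by (auto simp: cyl_def)

lemma cyl_mono: "n \<le> m \<Longrightarrow> cyl x m \<subseteq> cyl x n" by (auto simp: cyl_def)

lemma cyl_subset: "y \<in> cyl x n \<Longrightarrow> n \<le> m \<Longrightarrow> cyl y m \<subseteq> cyl x n" using cyl_eq cyl_mono by blast

lemma open_cyl: "open (cyl (x :: nat \<Rightarrow> 'a::discrete_topology) n)"
proof -
  have "cyl x n = {y. \<forall>i\<in>{..<n}. y (id i) \<in> {x i}}" by (auto simp: cyl_def)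
  also have "open \<dots>" by (rule product_topology_basis') (auto simp: open_discrete)
  finally show ?thesis .
qed

lemma open_contains_cyl:
  fixes U :: "(nat \<Rightarrow> 'a::topological_space) set"
  assumes "open U" "x \<in> U" shows "\<exists>n. cyl x n \<subseteq> U"
proof -
  have "openin (product_topology (\<lambda>i. euclidean) UNIV) U"
    using assms by (simp add: euclidean_product_topology)
  from product_topology_open_contains_basis[OF this assms(2)] obtain X where X:
    "x \<in> (\<Pi>\<^sub>E i\<in>UNIV. X i)" "finite {i. X i \<noteq> topspace euclidean}" "(\<Pi>\<^sub>E i\<in>UNIV. X i) \<subseteq> U" by blast
  obtain n where n: "\<And>i. X i \<noteq> UNIV \<Longrightarrow> i < n"
    using X(2) unfolding finite_nat_set_iff_bounded by auto
  have "cyl x n \<subseteq> (\<Pi>\<^sub>E i\<in>UNIV. X i)"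
  proof
    fix y assume y: "y \<in> cyl x n"
    have "y i \<in> X i" for i
      using n[of i] y X(1) by (cases "X i = UNIV") (auto simp: cyl_def PiE_iff)
    then show "y \<in> (\<Pi>\<^sub>E i\<in>UNIV. X i)" by auto
  qed
  with X(3) show ?thesis by blast
qed

lemma open_iff_cyl:
  fixes U :: "(nat \<Rightarrow> 'a::discrete_topology) set"
  shows "open U \<longleftrightarrow> (\<forall>x\<in>U. \<exists>n. cyl x n \<subseteq> U)"
proof
  assume R: "\<forall>x\<in>U. \<exists>n. cyl x n \<subseteq> U"
  show "open U"
  proof (subst open_subopen, intro ballI)
    fix x assume "x \<in> U"
    with R obtain n where "cyl x n \<subseteq> U" by blast
    then show "\<exists>T. open T \<and> x \<in> T \<and> T \<subseteq> U" by (intro exI[of _ "cyl x n"]) (simp add: open_cyl)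
  qed
qed (use open_contains_cyl in blast)

lemma closed_cyl: "closed (cyl (x :: nat \<Rightarrow> 'a::discrete_topology) n)"
  unfolding closed_def open_iff_cyl
proof
  fix y assume "y \<in> - cyl x n"
  then have "cyl y n \<subseteq> - cyl x n" by (auto simp: cyl_def)
  then show "\<exists>m. cyl y m \<subseteq> - cyl x n" ..
qed

lemma dense_iff_cyl:
  fixes U :: "(nat \<Rightarrow> 'a::discrete_topology) set"
  shows "closure U = UNIV \<longleftrightarrow> (\<forall>x n. cyl x n \<inter> U \<noteq> {})"
proof (intro iffI allI)
  fix x :: "nat \<Rightarrow> 'a" and n
  assume "closure U = UNIV"
  then have "x \<in> cyl x n \<inter> closure U" by simp
  then have "cyl x n \<inter> closure U \<noteq> {}" by blast
  then show "cyl x n \<inter> U \<noteq> {}"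
    using open_Int_closure_eq_empty[OF open_cyl, of x n U] by simp
next
  assume R: "\<forall>x n. cyl x n \<inter> U \<noteq> {}"
  have "x \<in> closure U" for x
    unfolding closure_iff_nhds_not_empty
  proof (intro allI impI)
    fix A V assume V: "V \<subseteq> A" "open V" "x \<in> V"
    then obtain n where "cyl x n \<subseteq> V" using open_contains_cyl by blast
    then show "U \<inter> A \<noteq> {}" using R[rule_format, of x n] V(1) by auto
  qed
  then show "closure U = UNIV" by auto
qed

lemma Baire_cyl:
  fixes \<W> :: "cantor set set"
  assumes "countable \<W>" "\<And>W. W \<in> \<W> \<Longrightarrow> open W \<and> closure W = UNIV"
  shows "\<exists>y\<in>cyl x n. \<forall>W\<in>\<W>. y \<in> W"
proof -
  let ?T = "product_topology (\<lambda>_. euclidean :: bool topology) (UNIV :: nat set)"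
  have T: "?T = euclidean" by (rule euclidean_product_topology)
  have cb: "compact_space (euclidean :: bool topology)"
    by (simp add: compact_space_def finite_imp_compact)
  have c: "compact_space (euclidean :: cantor topology)"
    using cb unfolding T[symmetric] compact_space_product_topology by blast
  have hb: "Hausdorff_space (euclidean :: bool topology)" unfolding Hausdorff_space_def disjnt_def
  proof (intro allI impI)
    fix u v :: bool assume "u \<in> topspace euclidean \<and> v \<in> topspace euclidean \<and> u \<noteq> v"
    then show "\<exists>U V. openin euclidean U \<and> openin euclidean V \<and> u \<in> U \<and> v \<in> V \<and> U \<inter> V = {}"
      by (intro exI[of _ "{u}"] exI[of _ "{v}"]) (auto simp: open_discrete)
  qed
  have h: "Hausdorff_space (euclidean :: cantor topology)"
    unfolding T[symmetric] Hausdorff_space_product_topology using hb by blast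
  have r: "regular_space (euclidean :: cantor topology)"
    by (rule compact_Hausdorff_imp_regular_space[OF c h])
  have "euclidean closure_of \<Inter>\<W> = topspace (euclidean :: cantor topology)"
    by (rule Baire_category) (use compact_imp_locally_compact_space[OF c] r assms in auto)
  then have "closure (\<Inter>\<W>) = UNIV" by simp
  then show ?thesis unfolding dense_iff_cyl by (metis Int_emptyI Inter_iff)
qed

section \<open>The dense open sets\<close>

lemma in_D_iff:
  "(x, y) \<in> D n \<longleftrightarrow> (\<exists>i\<ge>n. \<exists>j>i. 3 < weight i j \<and> (\<forall>k. i \<le> k \<and> k < j \<longrightarrow> x k \<noteq> y k))"
proof -
  have "(3 < delta i (enat j) x y) = (3 < weight i j)" if "\<forall>k. i \<le> k \<and> k < j \<longrightarrow> x k \<noteq> y k" for i j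
    using that by (simp add: delta_eq_ds ds_eq_weight)
  then show ?thesis unfolding D_def by auto
qed

lemma open_D: "open (D n)"
proof (subst open_subopen, intro ballI)
  fix p assume "p \<in> D n"
  then obtain x y where p: "p = (x, y)" "(x, y) \<in> D n" by (cases p) auto
  then obtain i j where ij: "n \<le> i" "i < j" "3 < weight i j" "\<And>k. i \<le> k \<Longrightarrow> k < j \<Longrightarrow> x k \<noteq> y k"
    unfolding in_D_iff by blast
  have "cyl x j \<times> cyl y j \<subseteq> D n"
  proof (clarify, unfold in_D_iff)
    fix x' y' assume "x' \<in> cyl x j" "y' \<in> cyl y j"
    then have "\<forall>k. i \<le> k \<and> k < j \<longrightarrow> x' k \<noteq> y' k" using ij(4) by (simp add: cyl_def)
    then show "\<exists>i\<ge>n. \<exists>j>i. 3 < weight i j \<and> (\<forall>k. i \<le> k \<and> k < j \<longrightarrow> x' k \<noteq> y' k)"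
      using ij(1-3) by blast
  qed
  then show "\<exists>T. open T \<and> p \<in> T \<and> T \<subseteq> D n"
    by (intro exI[of _ "cyl x j \<times> cyl y j"]) (simp add: p open_Times open_cyl)
qed

lemma box_meets_D:
  assumes "open U" "open V" "x \<in> U" "y \<in> V"
  shows "\<exists>a\<in>U. \<exists>b\<in>V. (a, b) \<in> D n"
proof -
  obtain q where q: "cyl y q \<subseteq> V" using assms open_contains_cyl by meson
  define i where "i = max n q"
  obtain j where j: "i < j" "3 < weight i j" using weight_unbounded by blast
  \<comment> \<open>The first \<open>i\<close> digits keep the second point in \<open>V\<close>;
    from there on it is the complement of \<open>x\<close>.\<close>
  let ?y = "\<lambda>k. if k < i then y k else \<not> x k"
  have "n \<le> i" by (simp add: i_def)
  moreover have "\<forall>k. i \<le> k \<and> k < j \<longrightarrow> x k \<noteq> ?y k" by simp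
  ultimately have "(x, ?y) \<in> D n" using j unfolding in_D_iff by blast
  moreover have "?y \<in> V" using q by (rule subsetD) (auto simp: cyl_def i_def)
  ultimately show ?thesis using assms by blast
qed

lemma dense_D: "closure (D n) = UNIV"
proof -
  have "p \<in> closure (D n)" for p
    unfolding closure_iff_nhds_not_empty
  proof (intro allI impI)
    fix A S assume S: "S \<subseteq> A" "open S" "p \<in> S"
    obtain x y where p: "p = (x, y)" by fastforce
    obtain U V where UV: "open U" "open V" "x \<in> U" "y \<in> V" "U \<times> V \<subseteq> S"
      using open_prod_elim[OF S(2,3)] unfolding p by (metis mem_Times_iff fst_conv snd_conv)
    from box_meets_D[OF UV(1-4)] obtain a b where "a \<in> U" "b \<in> V" "(a, b) \<in> D n" by blast
    then have "(a, b) \<in> D n \<inter> A" using UV(5) S(1) by auto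
    then show "D n \<inter> A \<noteq> {}" by blast
  qed
  then show ?thesis by auto
qed

lemma comeager_C: "comeager_in euclidean C"
  unfolding comeager_in_def C_def
  by (intro conjI exI[of _ D]) (auto simp: open_D dense_D)

text \<open>The property speaks of extensional tuples on \<open>{..<2}\<close>, so \<open>C\<close>
  is pulled back along \<open>x \<mapsto> (x 0, x 1)\<close>. Openness passes through continuity of
  this map, density through basic boxes.\<close>

lemma not_weak_mycielski_E2:
  assumes "\<And>B0 B1. Delta11 B0 \<Longrightarrow> Delta11 B1 \<Longrightarrow> reducible E2 UNIV E2 B0 \<Longrightarrow> reducible E2 UNIV E2 B1 \<Longrightarrow>
    saturation E2 B0 = saturation E2 B1 \<Longrightarrow> \<not> prod_E2 B0 B1 \<subseteq> C"
  shows "\<not> weak_mycielski 2 E2"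
proof
  let ?T = "product_topology (\<lambda>_. euclidean :: cantor topology) {..<2::nat}"
  let ?P = "\<lambda>x :: nat \<Rightarrow> cantor. (x 0, x 1)"
  let ?U = "\<lambda>n. {x \<in> topspace ?T. ?P x \<in> D n}"
  let ?C = "{x \<in> topspace ?T. ?P x \<in> C}"
  assume W: "weak_mycielski 2 E2"
  have "openin ?T (?U n)" for n
  proof -
    have "continuous_map ?T (prod_topology euclidean euclidean) ?P"
      by (intro continuous_map_pairedI continuous_map_product_projection) auto
    then show ?thesis
      by (rule openin_continuous_map_preimage) (simp add: open_D)
  qed
  moreover have "?T closure_of (?U n) = topspace ?T" for n
  proof -
    have "\<exists>y\<in>?U n. y \<in> S" if x: "x \<in> topspace ?T" and S: "openin ?T S" "x \<in> S" for x S
    proof -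
      from bspec[OF S(1)[unfolded openin_product_topology_alt] S(2)] obtain V
        where V: "\<forall>i\<in>{..<2}. open (V i)" "x \<in> (\<Pi>\<^sub>E i\<in>{..<2}. V i)" "(\<Pi>\<^sub>E i\<in>{..<2}. V i) \<subseteq> S"
        unfolding open_openin[symmetric] by (elim exE conjE)
      then have "open (V 0)" "open (V 1)" "x 0 \<in> V 0" "x 1 \<in> V 1" by auto
      from box_meets_D[OF this] obtain a b where ab: "a \<in> V 0" "b \<in> V 1" "(a, b) \<in> D n" by blast
      let ?y = "\<lambda>i\<in>{..<2::nat}. if i = 0 then a else b"
      have "?y \<in> (\<Pi>\<^sub>E i\<in>{..<2}. V i)" using ab by (auto simp: less_2_cases_iff)
      with V(3) have "?y \<in> S" by (rule subsetD)
      then show ?thesis using ab(3) by (intro bexI[of _ ?y]) auto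
    qed
    then show ?thesis unfolding closure_of_def by blast
  qed
  ultimately have "comeager_in ?T ?C"
    unfolding comeager_in_def by (intro conjI exI[of _ ?U]) (auto simp: C_def)
  from W[unfolded weak_mycielski_def, rule_format, OF this] obtain A
    where A: "\<forall>i<2. Delta11 (A i) \<and> bireducible E2 UNIV E2 (A i)"
      "\<forall>i<2. \<forall>j<2. saturation E2 (A i) = saturation E2 (A j)"
      "{x \<in> (\<Pi>\<^sub>E i\<in>{..<2}. A i). \<forall>i<2. \<forall>j<2. i \<noteq> j \<longrightarrow> \<not> E2 (x i) (x j)} \<subseteq> ?C"
    by (elim exE conjE)
  have "prod_E2 (A 0) (A 1) \<subseteq> C"
  proof
    fix p assume "p \<in> prod_E2 (A 0) (A 1)"
    then obtain a b where ab: "p = (a, b)" "a \<in> A 0" "b \<in> A 1" "\<not> E2 a b" by (auto simp: prod_E2_def)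
    let ?y = "\<lambda>i\<in>{..<2::nat}. if i = 0 then a else b"
    have "?y \<in> {x \<in> (\<Pi>\<^sub>E i\<in>{..<2}. A i). \<forall>i<2. \<forall>j<2. i \<noteq> j \<longrightarrow> \<not> E2 (x i) (x j)}"
      using ab E2_sym by (auto simp: less_2_cases_iff)
    with A(3) have "?y \<in> ?C" by (rule subsetD)
    then show "p \<in> C" using ab(1) by simp
  qed
  moreover have "\<not> prod_E2 (A 0) (A 1) \<subseteq> C"
    by (rule assms) (use A(1,2) in \<open>auto simp: bireducible_def\<close>)
  ultimately show False by blast
qed

section \<open>Block maps\<close>

lemma length_restr [simp]: "length (restr x n) = n"
  by (simp add: restr_def)

lemma Phi_nth:
  assumes mono: "\<And>s t. prefix s t \<Longrightarrow> prefix (h s) (h t)" and k: "k < length (h (restr x n))"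
  shows "Phi h x k = h (restr x n) ! k"
proof -
  have pre: "prefix (restr x a) (restr x b)" if "a \<le> b" for a b
    using that by (metis le_add_diff_inverse map_append prefixI restr_def upt_add_eq_append zero_le)
  have eq: "h (restr x a) ! k = h (restr x b) ! k" if "k < length (h (restr x a))" "k < length (h (restr x b))" for a b
    using mono[OF pre[of a b]] mono[OF pre[of b a]] that
    by (cases "a \<le> b") (auto simp: prefix_def nth_append)
  show ?thesis unfolding Phi_def
    by (rule the_equality) (use k eq in blast)+
qed

text \<open>
  The two arguments agree at the last digit of every odd block and differ there on every even one.
  An odd block is too heavy to be a place of total disagreement, so a run of total disagreement
  meets at most three consecutive blocks, on each of which the distance is at most 1.
\<close>

lemma Phi_pair_notin_C:
  fixes g :: "nat \<Rightarrow> bool list \<Rightarrow> bool list"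
  assumes m: "strict_mono (m :: nat \<Rightarrow> nat)"
    and len: "\<And>i s. i < 2 \<Longrightarrow> length (g i s) = m (length s)"
    and mono: "\<And>i s t. i < 2 \<Longrightarrow> prefix s t \<Longrightarrow> prefix (g i s) (g i t)"
    and same: "\<And>i k s t. i < 2 \<Longrightarrow> k > 0 \<Longrightarrow> length s = k \<Longrightarrow> length t = k \<Longrightarrow> s ! (k - 1) = t ! (k - 1) \<Longrightarrow>
         ds (m (k - 1)) (m k) (nth (g i s)) (nth (g i t)) < 1 / 2 ^ (k + 1)"
    and diff: "\<And>i k s t. i < 2 \<Longrightarrow> k > 0 \<Longrightarrow> length s = k \<Longrightarrow> length t = k \<Longrightarrow> s ! (k - 1) \<noteq> t ! (k - 1) \<Longrightarrow>
         \<bar>ds (m (k - 1)) (m k) (nth (g i s)) (nth (g i t)) - 1 / real k\<bar> < 1 / 2 ^ (k + 1)"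
    and cross: "\<And>i j k s. i < 2 \<Longrightarrow> j < 2 \<Longrightarrow> k > 0 \<Longrightarrow> length s = k \<Longrightarrow>
         ds (m (k - 1)) (m k) (nth (g i s)) (nth (g j s)) < 1 / 2 ^ (k + 1)"
  shows "(Phi (g 0) (\<lambda>_. False), Phi (g 1) (\<lambda>k. odd k)) \<notin> C"
proof -
  define x where "x = Phi (g 0) (\<lambda>_. False)"
  define y where "y = Phi (g 1) (\<lambda>k. odd k)"
  \<comment> \<open>For \<open>k > 0\<close> this says \<open>3 / 2 ^ (k + 1) \<le> 1 / k\<close>:
    the weight of an odd block, which exceeds \<open>1 / k - 1 / 2 ^ (k + 1)\<close>, is then at
    least the bound \<open>1 / 2 ^ k\<close> on the distance there.\<close>
  have two_pow: "3 * real k \<le> 2 * 2 ^ k" for k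
  proof (induction k)
    case (Suc k)
    then show ?case by (cases "k = 0"; cases "k = 1") (auto intro: order_trans[of _ "6 * real k"])
  qed auto
  have blk: "ds (m (k - 1)) (m k) x y =
      ds (m (k - 1)) (m k) (nth (g 0 (restr (\<lambda>_. False) k))) (nth (g 1 (restr odd k)))" for k
  proof (rule ds_cong)
    fix l assume "l < m k"
    then show "x l = g 0 (restr (\<lambda>_. False) k) ! l" "y l = g 1 (restr odd k) ! l"
      unfolding x_def y_def using mono[of 0] mono[of 1] by (auto intro!: Phi_nth simp: len length_restr)
  qed
  \<comment> \<open>The detour goes through \<open>g 1\<close> at the zero string:
    \<open>cross\<close> changes the map at a fixed argument, after which \<open>same\<close> or
    \<open>diff\<close> changes the argument under a fixed map.\<close>
  have tri: "ds (m (k - 1)) (m k) x y < 1 / 2 ^ (k + 1) +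
      ds (m (k - 1)) (m k) (nth (g 1 (restr (\<lambda>_. False) k))) (nth (g 1 (restr odd k)))" if "k > 0" for k
    unfolding blk using cross[of 0 1 k "restr (\<lambda>_. False) k"] that
      ds_triangle[of "m (k - 1)" "m k" "nth (g 0 (restr (\<lambda>_. False) k))" "nth (g 1 (restr odd k))"
        "nth (g 1 (restr (\<lambda>_. False) k))"]
    by (auto simp: restr_def)
  have last: "restr z k ! (k - 1) = z (k - 1)" if "k > 0" for z k
    using that by (simp add: restr_def)
  have lenr: "length (restr z k) = k" for z k by (simp add: restr_def)
  have odd_block: "ds (m (k - 1)) (m k) x y < 1 / 2 ^ k" if "odd k" for k
  proof -
    have "k > 0" using that by (cases k) auto
    moreover have "\<not> odd (k - 1)" using that by simp
    ultimately show ?thesis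
      using tri[of k] same[of 1 k "restr (\<lambda>_. False) k" "restr odd k"] lenr last by auto
  qed
  have block_le: "ds (m (k - 1)) (m k) x y \<le> 1" if "k > 0" for k
  proof (cases "odd k")
    case True
    have "1 / 2 ^ k \<le> (1 :: real)" by simp
    then show ?thesis using odd_block[OF True] by linarith
  next
    case False
    then have k2: "k \<ge> 2" using that by presburger
    have "odd (k - 1)" using False that by simp
    then have "ds (m (k - 1)) (m k) x y < 1 / 2 ^ (k + 1) + (1 / k + 1 / 2 ^ (k + 1))"
      using tri[of k] diff[of 1 k "restr (\<lambda>_. False) k" "restr odd k"] lenr last that by auto
    moreover have "1 / real k \<le> 1 / 2" using k2 by (simp add: divide_simps)
    moreover have "1 / 2 ^ (k + 1) \<le> (1 / 2 ^ 2 :: real)"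
      using k2 by (intro divide_left_mono power_increasing) auto
    then have "1 / 2 ^ (k + 1) \<le> (1 / 4 :: real)" by simp
    ultimately show ?thesis by linarith
  qed
  have block_weight: "1 / real k - 1 / 2 ^ (k + 1) < weight (m (k - 1)) (m k)" if "k > 0" for k
  proof -
    let ?s = "restr (\<lambda>_. False) k" and ?t = "restr (\<lambda>_. True) k"
    have "\<bar>ds (m (k - 1)) (m k) (nth (g 0 ?s)) (nth (g 0 ?t)) - 1 / real k\<bar> < 1 / 2 ^ (k + 1)"
      by (rule diff) (use that lenr last in auto)
    then show ?thesis using ds_le_weight[of "m (k - 1)" "m k" "nth (g 0 ?s)" "nth (g 0 ?t)"] by linarith
  qed
  have odd_agree: "\<exists>l\<ge>m (k - 1). l < m k \<and> x l = y l" if "odd k" for k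
  proof (rule ccontr)
    assume "\<not> ?thesis"
    then have "ds (m (k - 1)) (m k) x y = weight (m (k - 1)) (m k)" by (intro ds_eq_weight) auto
    moreover have k: "k > 0" using that by (cases k) auto
    ultimately have "1 / real k - 1 / 2 ^ (k + 1) < 1 / 2 ^ k"
      using block_weight[of k] odd_block[OF that] by linarith
    then have "2 * 2 ^ k < 3 * real k" using k by (simp add: field_simps)
    then show False using two_pow[of k] by linarith
  qed
  \<comment> \<open>The blocks start at \<open>m 0\<close>, so a run starting at or after
    \<open>m 0\<close> starts inside some block.\<close>
  have "(x, y) \<notin> D (m 0)"
  proof
    assume "(x, y) \<in> D (m 0)"
    then obtain i j where ij: "m 0 \<le> i" "i < j" "3 < weight i j"
        "\<And>l. i \<le> l \<Longrightarrow> l < j \<Longrightarrow> x l \<noteq> y l"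
      unfolding in_D_iff by blast
    let ?k = "GREATEST k. m k \<le> i"
    have bd: "\<And>k. m k \<le> i \<Longrightarrow> k \<le> i" using strict_mono_imp_increasing[OF m] order_trans by blast
    define k where "k = ?k"
    have k: "m k \<le> i" unfolding k_def by (rule GreatestI_nat[of "\<lambda>k. m k \<le> i", OF ij(1) bd])
    have k': "i < m (Suc k)"
      using Greatest_le_nat[of "\<lambda>k. m k \<le> i" "Suc k" i] bd unfolding k_def[symmetric]
      by (metis Suc_n_not_le_n not_le)
    have le: "m a \<le> m b" if "a \<le> b" for a b using m that by (simp add: strict_mono_less_eq)
    have "j \<le> m (k + 3)"
    proof (rule ccontr)
      assume j: "\<not> j \<le> m (k + 3)"
      \<comment> \<open>Block \<open>k + 1\<close>, from \<open>m k\<close> to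
        \<open>m (k + 1)\<close>, may be covered only from \<open>i\<close> on, so the first two
        blocks certain to be covered are \<open>k + 2\<close> and \<open>k + 3\<close>; one of them
        is odd.\<close>
      obtain l where l: "l = k + 2 \<or> l = k + 3" "odd l" by (cases "odd k") force+
      from odd_agree[OF l(2)] obtain r where r: "m (l - 1) \<le> r" "r < m l" "x r = y r" by blast
      have "i \<le> r" using r(1) k' le[of "Suc k" "l - 1"] l(1) by auto
      moreover have "r < j" using r(2) j le[of l "k + 3"] l(1) by auto
      ultimately show False using ij(4) r(3) by blast
    qed
    then have "ds i j x y \<le> ds (m k) (m (k + 3)) x y" using k by (intro ds_mono) auto
    also have "\<dots> = ds (m k) (m (k + 1)) x y + ds (m (k + 1)) (m (k + 2)) x y + ds (m (k + 2)) (m (k + 3)) x y"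
      using ds_split[of "m k" "m (k + 1)" "m (k + 3)"] ds_split[of "m (k + 1)" "m (k + 2)" "m (k + 3)"]
      by (simp add: le)
    also have "\<dots> \<le> 3" using block_le[of "k + 1"] block_le[of "k + 2"] block_le[of "k + 3"] by simp
    finally show False using ij(3) ds_eq_weight[of i j x y] ij(4) by auto
  qed
  then show ?thesis unfolding C_def x_def y_def by blast
qed

section \<open>The Baire property of boldface Delta-1-1 sets\<close>

text \<open>
  The Baire property of \<open>A\<close> in the form in which it is used: a comeager intersection on which
  membership in \<open>A\<close> is locally constant.
\<close>

definition decided_on :: "'a::topological_space set set \<Rightarrow> 'a set \<Rightarrow> bool" where
  "decided_on \<W> A \<longleftrightarrow> countable \<W> \<and> (\<forall>W\<in>\<W>. open W \<and> closure W = UNIV) \<and>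
     (\<forall>x\<in>\<Inter>\<W>. \<exists>U. open U \<and> x \<in> U \<and> (U \<inter> \<Inter>\<W> \<subseteq> A \<or> U \<inter> \<Inter>\<W> \<subseteq> - A))"

lemma decided_onD:
  assumes "decided_on \<W> A" "x \<in> \<Inter>\<W>"
  shows "\<exists>U. open U \<and> x \<in> U \<and> (U \<inter> \<Inter>\<W> \<subseteq> A \<or> U \<inter> \<Inter>\<W> \<subseteq> - A)"
  using conjunct2[OF conjunct2[OF assms(1)[unfolded decided_on_def]]] assms(2) by (rule bspec)

definition baire_property :: "'a::topological_space set \<Rightarrow> bool" where
  "baire_property A \<longleftrightarrow> (\<exists>\<W>. decided_on \<W> A)"

lemma baire_property_Compl: "baire_property A \<Longrightarrow> baire_property (- A)"
  unfolding baire_property_def decided_on_def by (simp add: disj_commute)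

text \<open>Only the boundary of an open set is lost, and it is nowhere dense. Intersecting with
  this set lets a generic point be either inside \<open>U\<close> or in its exterior.\<close>

lemma dense_open_Un_exterior:
  assumes "open U" shows "open (U \<union> (- closure U)) \<and> closure (U \<union> (- closure U)) = UNIV"
proof -
  have "closure U \<union> (- closure U) \<subseteq> closure (U \<union> (- closure U))"
    using closure_subset[of "- closure U"] closure_mono[of U "U \<union> (- closure U)"]
      closure_mono[of "- closure U" "U \<union> (- closure U)"] by blast
  then show ?thesis using assms by auto
qed

lemma baire_property_open:
  assumes "open A" shows "baire_property A"
proof -
  let ?W = "A \<union> - closure A"
  have "decided_on {?W} A"
    unfolding decided_on_def
  proof (intro conjI ballI)
    fix x assume "x \<in> \<Inter>{?W}"
    then consider "x \<in> A" | "x \<in> - closure A" by blast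
    then show "\<exists>U. open U \<and> x \<in> U \<and> (U \<inter> \<Inter>{?W} \<subseteq> A \<or> U \<inter> \<Inter>{?W} \<subseteq> - A)"
    proof cases
      case 1 then show ?thesis using assms by blast
    next
      case 2
      then show ?thesis using closure_subset[of A]
        by (intro exI[of _ "- closure A"]) auto
    qed
  qed (use dense_open_Un_exterior[OF assms] in auto)
  then show ?thesis unfolding baire_property_def by blast
qed

text \<open>\<open>U\<close> is the largest open set whose generic points all lie in the union. A
  generic point of some \<open>A i\<close> has a neighbourhood deciding \<open>A i\<close>
  positively, and that neighbourhood is part of \<open>U\<close>; hence the exterior of
  \<open>U\<close> contains no generic point of the union.\<close>

lemma baire_property_UN:
  fixes A :: "'i::countable \<Rightarrow> 'a::topological_space set"
  assumes "\<And>i. baire_property (A i)" shows "baire_property (\<Union>i. A i)"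
proof -
  obtain \<V> where \<V>: "\<And>i. decided_on (\<V> i) (A i)"
    using assms unfolding baire_property_def by metis
  define G where "G = \<Inter>(\<Union>i. \<V> i)"
  define U where "U = \<Union>{S. open S \<and> S \<inter> G \<subseteq> (\<Union>i. A i)}"
  let ?W = "insert (U \<union> - closure U) (\<Union>i. \<V> i)"
  have U: "open U" unfolding U_def by blast
  have sub: "\<Inter>?W \<subseteq> G" unfolding G_def by blast
  have "decided_on ?W (\<Union>i. A i)"
    unfolding decided_on_def
  proof (intro conjI ballI)
    show "countable ?W" using \<V> unfolding decided_on_def by auto
    show "open W" "closure W = UNIV" if "W \<in> ?W" for W
      using that \<V> dense_open_Un_exterior[OF U] unfolding decided_on_def by auto
    fix x assume x: "x \<in> \<Inter>?W"
    then consider "x \<in> U" | "x \<in> - closure U" by blast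
    then show "\<exists>S. open S \<and> x \<in> S \<and> (S \<inter> \<Inter>?W \<subseteq> (\<Union>i. A i) \<or> S \<inter> \<Inter>?W \<subseteq> - (\<Union>i. A i))"
    proof cases
      case 1
      then obtain S where "open S" "x \<in> S" "S \<inter> G \<subseteq> (\<Union>i. A i)" unfolding U_def by blast
      moreover from this(3) have "S \<inter> \<Inter>?W \<subseteq> (\<Union>i. A i)" using sub by (meson Int_mono order_refl order_trans)
      ultimately show ?thesis by (intro exI[of _ S]) simp
    next
      case 2
      have "y \<notin> A i" if y: "y \<in> - closure U" "y \<in> \<Inter>?W" for y i
      proof
        assume "y \<in> A i"
        have "y \<in> \<Inter>(\<V> i)" using y(2) by auto
        then obtain S where S: "open S" "y \<in> S" "S \<inter> \<Inter>(\<V> i) \<subseteq> A i \<or> S \<inter> \<Inter>(\<V> i) \<subseteq> - A i"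
          using decided_onD[OF \<V>] by meson
        have "y \<in> S \<inter> \<Inter>(\<V> i)" using S(2) \<open>y \<in> \<Inter>(\<V> i)\<close> by (rule IntI)
        with \<open>y \<in> A i\<close> S(3) have "S \<inter> \<Inter>(\<V> i) \<subseteq> A i" by (meson ComplD subsetD)
        moreover have "G \<subseteq> \<Inter>(\<V> i)" unfolding G_def by (rule Inter_anti_mono) (rule UN_upper, simp)
        ultimately have "S \<inter> G \<subseteq> (\<Union>i. A i)" by (meson Int_mono UN_upper UNIV_I order_refl order_trans)
        then have "y \<in> U" unfolding U_def by (intro UnionI[OF _ S(2)] CollectI conjI S(1))
        then show False using y(1) closure_subset[of U] by (meson ComplD subsetD)
      qed
      then have "- closure U \<inter> \<Inter>?W \<subseteq> - (\<Union>i. A i)" by (meson ComplI IntD1 IntD2 UN_E subsetI)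
      then show ?thesis using 2 by (intro exI[of _ "- closure U"]) auto
    qed
  qed
  then show ?thesis unfolding baire_property_def by blast
qed

lemma baire_property_INT:
  fixes A :: "'i::countable \<Rightarrow> 'a::topological_space set"
  assumes "\<And>i. baire_property (A i)" shows "baire_property (\<Inter>i. A i)"
  using baire_property_Compl[OF baire_property_UN, of "\<lambda>i. - A i"] baire_property_Compl[OF assms] by simp

section \<open>Separation of analytic sets by sets with the Baire property\<close>

definition separable :: "'a::topological_space set \<Rightarrow> 'a set \<Rightarrow> bool" where
  "separable P Q \<longleftrightarrow> (\<exists>R. baire_property R \<and> P \<subseteq> R \<and> Q \<inter> R = {})"

lemma separable_UN:
  fixes P :: "'i::countable \<Rightarrow> 'a::topological_space set" and Q :: "'j::countable \<Rightarrow> 'a set"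
  assumes "\<And>i j. separable (P i) (Q j)" shows "separable (\<Union>i. P i) (\<Union>j. Q j)"
proof -
  obtain R where R: "\<And>i j. baire_property (R i j) \<and> P i \<subseteq> R i j \<and> Q j \<inter> R i j = {}"
    using assms unfolding separable_def by metis
  have "baire_property (\<Union>i. \<Inter>j. R i j)"
    by (intro baire_property_UN baire_property_INT) (use R in blast)
  then show ?thesis unfolding separable_def
    by (intro exI[of _ "\<Union>i. \<Inter>j. R i j"]) (use R in blast)
qed

text \<open>The Suslin scheme of the projection of \<open>K\<close>. A word records digits of the
  point together with those of the witness, so an infinite branch determines both.\<close>

definition branch :: "(cantor \<times> (nat \<Rightarrow> nat)) set \<Rightarrow> (bool \<times> nat) list \<Rightarrow> cantor set" where
  "branch K w = {x. \<exists>a. (x, a) \<in> K \<and> map (\<lambda>i. (x i, a i)) [0..<length w] = w}"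

lemma branch_Nil: "branch K [] = fst ` K"
  by (force simp: branch_def)

lemma branch_split: "branch K w = (\<Union>c. branch K (w @ [c]))"
  by (auto simp: branch_def)

text \<open>Nonempty branches only provide elements of \<open>K\<close> that agree with the word
  \<open>w n\<close> for each \<open>n\<close>; closedness of \<open>K\<close> puts their limit into
  \<open>K\<close>.\<close>

lemma branch_limit:
  assumes "closed K" and w: "\<And>n. length (w n) = n" "\<And>n. w (Suc n) = w n @ [c n]"
    and ne: "\<And>n. branch K (w n) \<noteq> {}"
  shows "(\<lambda>i. fst (c i)) \<in> fst ` K" "branch K (w (Suc i)) \<subseteq> {x. x i = fst (c i)}"
proof -
  have wn: "w n = map c [0..<n]" for n
    by (induction n) (use w in auto)
  let ?x = "\<lambda>i. fst (c i)" and ?a = "\<lambda>i. snd (c i)"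
  obtain xs as where xa: "\<And>n. (xs n, as n) \<in> K \<and> (\<forall>i<n. (xs n i, as n i) = c i)"
  proof -
    have "\<exists>x a. (x, a) \<in> K \<and> (\<forall>i<n. (x i, a i) = c i)" for n
      using ne[of n] by (simp add: branch_def wn Ball_def)
    then show ?thesis using that by metis
  qed
  have "(?x, ?a) \<in> K"
  proof (rule ccontr)
    assume "(?x, ?a) \<notin> K"
    then have "(?x, ?a) \<in> - K" by simp
    moreover have "open (- K)" using \<open>closed K\<close> by (simp add: closed_def)
    ultimately obtain A B where AB: "open A" "open B" "?x \<in> A" "?a \<in> B" "A \<times> B \<subseteq> - K"
      using open_prod_elim by (metis mem_Times_iff fst_conv snd_conv)
    obtain p q where pq: "cyl ?x p \<subseteq> A" "cyl ?a q \<subseteq> B" using AB open_contains_cyl by meson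
    let ?n = "max p q"
    have e: "(xs ?n i, as ?n i) = c i" if "i < ?n" for i using xa that by blast
    have "xs ?n i = fst (c i)" "as ?n i = snd (c i)" if "i < ?n" for i
      using e[OF that] by (metis fst_conv, metis snd_conv)
    then have "xs ?n \<in> cyl ?x p" "as ?n \<in> cyl ?a q" by (auto simp: cyl_def)
    then have "(xs ?n, as ?n) \<in> - K" using pq AB(5) by blast
    then show False using xa by blast
  qed
  then show "(\<lambda>i. fst (c i)) \<in> fst ` K" by (metis fst_conv imageI)
  show "branch K (w (Suc i)) \<subseteq> {x. x i = fst (c i)}"
  proof
    fix x assume "x \<in> branch K (w (Suc i))"
    then obtain a where "map (\<lambda>i. (x i, a i)) [0..<Suc i] = map c [0..<Suc i]"
      unfolding branch_def wn by auto
    then have "(x i, a i) = c i" by simp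
    then show "x \<in> {x. x i = fst (c i)}" by (simp add: prod_eq_iff[symmetric]) (metis fst_conv)
  qed
qed

text \<open>
  Lusin's separation argument: inseparability descends along a pair of branches, whose limits are
  a point of \<open>A\<close> and a point of \<open>B\<close>; these differ at some digit, and that digit separates.
\<close>

lemma separable_Sigma11:
  fixes A B :: "cantor set"
  assumes "Sigma11 A" "Sigma11 B" "A \<inter> B = {}"
  shows "separable A B"
proof (rule ccontr)
  assume ns: "\<not> separable A B"
  obtain K L :: "(cantor \<times> (nat \<Rightarrow> nat)) set" where KL: "closed K" "A = fst ` K" "closed L" "B = fst ` L"
    using assms unfolding Sigma11_def by blast
  let ?P = "\<lambda>n (v, w). length v = n \<and> length w = n \<and> \<not> separable (branch K v) (branch L w)"
  let ?Q = "\<lambda>(n::nat) (v, w) (v', w'). (\<exists>c. v' = v @ [c]) \<and> (\<exists>d. w' = w @ [d])"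
  have "\<exists>f. \<forall>n. ?P n (f n) \<and> ?Q n (f n) (f (Suc n))"
  proof (rule dependent_nat_choice)
    show "\<exists>p. ?P 0 p" using ns KL by (intro exI[of _ "([], [])"]) (simp add: branch_Nil)
    fix p n assume p: "?P n p"
    obtain v w where vw: "p = (v, w)" by fastforce
    obtain c d where "\<not> separable (branch K (v @ [c])) (branch L (w @ [d]))"
      using separable_UN[of "\<lambda>c. branch K (v @ [c])" "\<lambda>d. branch L (w @ [d])"] p
      unfolding vw by (auto simp: branch_split[symmetric])
    then show "\<exists>q. ?P (Suc n) q \<and> ?Q n p q" using p unfolding vw
      by (intro exI[of _ "(v @ [c], w @ [d])"]) simp
  qed
  then obtain f where f: "\<And>n. ?P n (f n) \<and> ?Q n (f n) (f (Suc n))" by blast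
  define v w where "v = fst \<circ> f" and "w = snd \<circ> f"
  have vw: "length (v n) = n" "length (w n) = n" "\<not> separable (branch K (v n)) (branch L (w n))"
    "\<exists>c. v (Suc n) = v n @ [c]" "\<exists>d. w (Suc n) = w n @ [d]" for n
    using f[of n] unfolding v_def w_def by (auto simp: case_prod_beta)
  obtain c d where cd: "\<And>n. v (Suc n) = v n @ [c n]" "\<And>n. w (Suc n) = w n @ [d n]"
    using vw(4,5) by metis
  \<comment> \<open>An empty first piece would be separated by \<open>{}\<close>, an empty second
    one by \<open>UNIV\<close>.\<close>
  have ne: "branch K (v n) \<noteq> {}" "branch L (w n) \<noteq> {}" for n
    using vw(3)[of n] baire_property_open[OF open_empty] baire_property_open[OF open_UNIV]
    unfolding separable_def by blast+
  note K = branch_limit[OF KL(1) vw(1) cd(1) ne(1)]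
  note L = branch_limit[OF KL(3) vw(2) cd(2) ne(2)]
  have "(\<lambda>i. fst (c i)) \<noteq> (\<lambda>i. fst (d i))" using K(1) L(1) KL(2,4) assms(3) by (metis IntI empty_iff)
  then obtain i where i: "fst (c i) \<noteq> fst (d i)" by blast
  have "open {x :: cantor. x i = fst (c i)}"
    unfolding open_iff_cyl by (intro ballI exI[of _ "Suc i"]) (auto simp: cyl_def)
  then have "separable (branch K (v (Suc i))) (branch L (w (Suc i)))"
    unfolding separable_def
    by (intro exI[of _ "{x. x i = fst (c i)}"] conjI baire_property_open) (use K(2) L(2) i in blast)+
  then show False using vw(3) by blast
qed

text \<open>Suslin's argument: the only set separating \<open>A\<close> from its complement is
  \<open>A\<close> itself.\<close>

lemma Delta11_baire_property:
  fixes A :: "cantor set"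
  assumes "Delta11 A" shows "baire_property A"
proof -
  obtain R where R: "baire_property R" "A \<subseteq> R" "- A \<inter> R = {}"
    using separable_Sigma11[of A "- A"] assms unfolding Delta11_def separable_def by auto
  then have "R = A" by blast
  then show ?thesis using R by simp
qed

section \<open>Generic continuity and fusion\<close>

definition flip :: "nat set \<Rightarrow> cantor \<Rightarrow> cantor" where
  "flip F x = (\<lambda>i. x i \<noteq> (i \<in> F))"

lemma flip_empty [simp]: "flip {} x = x" by (simp add: flip_def)

lemma flip_flip: "flip E (flip F x) = flip ((E - F) \<union> (F - E)) x"
  by (auto simp: flip_def)

lemma flip_flip_disjoint: "E \<inter> F = {} \<Longrightarrow> flip E (flip F x) = flip (E \<union> F) x"
  by (auto simp: flip_def)

lemma flip_in_cyl: "F \<subseteq> {n..} \<Longrightarrow> y \<in> cyl x n \<Longrightarrow> flip F y \<in> cyl x n"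
  by (force simp: flip_def cyl_def)

lemma flip_cyl_flip: "y \<in> cyl x n \<Longrightarrow> flip F y \<in> cyl (flip F x) n"
  by (simp add: flip_def cyl_def)

lemma ds_flip: "ds a b x (flip F x) = (\<Sum>i\<in>F \<inter> {a..<b}. 1 / (real i + 1))"
proof -
  have "ds a b x (flip F x) = (\<Sum>i=a..<b. if i \<in> F then 1 / (real i + 1) else 0)"
    unfolding ds_def by (rule sum.cong) (auto simp: flip_def)
  also have "\<dots> = (\<Sum>i\<in>F \<inter> {a..<b}. 1 / (real i + 1))"
    using sum.inter_restrict[of "{a..<b}" "\<lambda>i. 1 / (real i + 1)" F] by (simp add: Int_commute)
  finally show ?thesis .
qed

lemma E2_flip_finite: "finite F \<Longrightarrow> E2 x (flip F x)"
  unfolding E2_iff_ds ds_flip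
  by (intro exI[of _ "\<Sum>i\<in>F. 1 / (real i + 1)"] allI sum_mono2) auto

lemma E2_flip_summable:
  assumes F: "\<And>k. finite (F k)" "\<And>k. (\<Sum>i\<in>F k. 1 / (real i + 1)) \<le> (1/2) ^ k"
  shows "E2 x (flip (\<Union>k. F k) x)"
  unfolding E2_iff_ds ds_flip
proof (intro exI[of _ 2] allI)
  fix N
  let ?w = "\<lambda>A. \<Sum>i\<in>A. 1 / (real i + 1)"
  let ?A = "(\<Union>k. F k) \<inter> {0..<N}"
  have "\<forall>i\<in>?A. \<exists>k. i \<in> F k" by blast
  \<comment> \<open>One index per digit suffices to cover the finite set \<open>?A\<close> by
    finitely many \<open>F k\<close>. These may overlap, so their weights are added by
    subadditivity.\<close>
  then obtain h where h: "\<forall>i\<in>?A. i \<in> F (h i)" by metis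
  have "finite (h ` ?A)" by simp
  then obtain K where K: "\<forall>k\<in>h ` ?A. k < K" unfolding finite_nat_set_iff_bounded by blast
  have "?A \<subseteq> (\<Union>k<K. F k)" using h K by blast
  then have "?w ?A \<le> ?w (\<Union>k<K. F k)" by (intro sum_mono2) (auto intro: F(1))
  also have "\<dots> \<le> (\<Sum>k<K. (1/2) ^ k)"
  proof (induction K)
    case (Suc K)
    have fin: "finite (\<Union>k<K. F k)" using F(1) by blast
    have "?w (\<Union>k<Suc K. F k) = ?w ((\<Union>k<K. F k) \<union> F K)" by (simp add: lessThan_Suc Un_commute)
    also have "\<dots> = ?w (\<Union>k<K. F k) + ?w (F K) - ?w ((\<Union>k<K. F k) \<inter> F K)"
      by (rule sum_Un[OF fin F(1)])
    also have "\<dots> \<le> ?w (\<Union>k<K. F k) + ?w (F K)" by (simp add: sum_nonneg)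
    also have "\<dots> \<le> (\<Sum>k<Suc K. (1/2) ^ k)" using Suc F(2)[of K] by simp
    finally show ?case .
  qed simp
  also have "\<dots> \<le> 2" by (simp add: geometric_sum)
  finally show "?w ?A \<le> 2" .
qed

lemma not_E2_flip_atLeast: "\<not> E2 x (flip {n..} x)"
proof
  assume "E2 x (flip {n..} x)"
  then obtain B where B: "\<And>N. ds 0 N x (flip {n..} x) \<le> B" unfolding E2_iff_ds by blast
  obtain b where b: "n < b" "B < weight n b" using weight_unbounded by blast
  have "weight n b = ds n b x (flip {n..} x)" by (rule ds_eq_weight[symmetric]) (simp add: flip_def)
  also have "\<dots> \<le> ds 0 b x (flip {n..} x)" by (rule ds_mono) auto
  finally show False using b(2) B[of b] by simp
qed

text \<open>\<open>G\<close> is closed under flips because the arguments compare the value at a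
  generic point with the value at its flip, and continuity has to hold at both. Finite flips make
  the equivalent partners; flips of all digits from some place on give an inequivalent point that is
  still generic.\<close>

locale generic_reduction =
  fixes W :: "nat \<Rightarrow> cantor set" and f :: "cantor \<Rightarrow> cantor"
    and G :: "cantor set"
  defines "G \<equiv> \<Inter>n. W n"
  assumes open_W: "open (W n)" and dense_W: "closure (W n) = UNIV"
    and flip_in: "x \<in> G \<Longrightarrow> finite F \<or> finite (- F) \<Longrightarrow> flip F x \<in> G"
    and continuous: "x \<in> G \<Longrightarrow> \<exists>n. \<forall>y\<in>cyl x n \<inter> G. f y k = f x k"
    and reduction: "E2 (f x) (f y) \<longleftrightarrow> E2 x y"
begin

lemma continuous_upto:
  assumes "x \<in> G" shows "\<exists>n\<ge>p. \<forall>y\<in>cyl x n \<inter> G. \<forall>k<N. f y k = f x k"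
proof -
  obtain h where h: "\<And>k y. y \<in> cyl x (h k) \<inter> G \<Longrightarrow> f y k = f x k"
    using continuous[OF assms] by metis
  let ?n = "Max (insert p (h ` {..<N}))"
  have "f y k = f x k" if "y \<in> cyl x ?n \<inter> G" "k < N" for y k
  proof -
    have "h k \<le> ?n" using that(2) by (intro Max_ge) auto
    then show ?thesis using h[of y k] cyl_mono[of "h k" ?n x] that(1) by blast
  qed
  moreover have "p \<le> ?n" by (intro Max_ge) auto
  ultimately show ?thesis by blast
qed

lemma continuous_upto_flip:
  assumes "x \<in> G" "finite F"
  shows "\<exists>n\<ge>p. \<forall>y\<in>cyl x n \<inter> G. \<forall>k<N. f y k = f x k \<and> f (flip F y) k = f (flip F x) k"
proof -
  obtain n where n: "n \<ge> p" "\<forall>y\<in>cyl x n \<inter> G. \<forall>k<N. f y k = f x k"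
    using continuous_upto[OF assms(1)] by blast
  have "flip F x \<in> G" using flip_in assms by blast
  then obtain n' where n': "n' \<ge> n" "\<forall>y\<in>cyl (flip F x) n' \<inter> G. \<forall>k<N. f y k = f (flip F x) k"
    using continuous_upto by blast
  have "f y k = f x k \<and> f (flip F y) k = f (flip F x) k" if "y \<in> cyl x n' \<inter> G" "k < N" for y k
    using that n(2) n' cyl_mono[OF n'(1), of x] flip_cyl_flip[of y x n' F] flip_in[of y F] assms(2) by blast
  then show ?thesis using n(1) n'(1) by (intro exI[of _ n']) auto
qed

text \<open>A uniform form of the equivalence of \<open>f y\<close> and \<open>f (flip E y)\<close>:
  one starting place and one bound for all generic points of a cylinder, so that it survives further
  changes of the point inside the cylinder.\<close>

definition tail_small :: "nat set \<Rightarrow> cantor \<Rightarrow> nat \<Rightarrow> nat \<Rightarrow> real \<Rightarrow> bool" where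
  "tail_small E z n M c \<longleftrightarrow> (\<forall>y\<in>cyl z n \<inter> G. \<forall>N. ds M N (f y) (f (flip E y)) \<le> c)"

lemma tail_smallD: "tail_small E z n M c \<Longrightarrow> y \<in> cyl z n \<Longrightarrow> y \<in> G \<Longrightarrow> ds M N (f y) (f (flip E y)) \<le> c"
  unfolding tail_small_def by blast

lemma tail_small_subcyl:
  "tail_small E z n M c \<Longrightarrow> z' \<in> cyl z n \<Longrightarrow> n \<le> n' \<Longrightarrow> tail_small E z' n' M c"
  unfolding tail_small_def using cyl_subset[of z' z n n'] by blast

lemma dense_G: "\<exists>y\<in>cyl x n. y \<in> G"
  using Baire_cyl[of "range W" x n] open_W dense_W unfolding G_def by auto

text \<open>
  Baire category: each point of \<open>G\<close> has some small tail, hence a single \<open>M\<close> works on a subcylinder.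
\<close>

lemma ex_tail_small:
  assumes E: "finite E" and c: "0 < c"
  shows "\<exists>z'\<in>cyl z n \<inter> G. \<exists>n'\<ge>n. \<exists>M\<ge>M0. tail_small E z' n' M c"
proof (rule ccontr)
  assume neg: "\<not> ?thesis"
  \<comment> \<open>An excess over \<open>c\<close> up to a finite \<open>N\<close> depends on
    finitely many digits of the values, so by continuity it persists on a cylinder. If the claim
    fails, each \<open>V M\<close> is therefore dense in \<open>cyl z n\<close>, and adding the
    complement of this cylinder makes it dense everywhere. A generic point in all \<open>V M\<close>
    contradicts \<open>E2_tail\<close>.\<close>
  define V where "V M = {x. \<exists>N p. \<forall>y\<in>cyl x p \<inter> G. c < ds M N (f y) (f (flip E y))}" for M
  have V: "open (V M \<union> - cyl z n)" "closure (V M \<union> - cyl z n) = UNIV" for M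
  proof -
    have "open (V M)" unfolding open_iff_cyl
    proof
      fix x assume "x \<in> V M"
      then obtain N p where p: "\<forall>y\<in>cyl x p \<inter> G. c < ds M N (f y) (f (flip E y))" unfolding V_def by blast
      then have "cyl x p \<subseteq> V M" unfolding V_def using cyl_eq by blast
      then show "\<exists>p. cyl x p \<subseteq> V M" ..
    qed
    then show "open (V M \<union> - cyl z n)" using closed_cyl by (intro open_Un) auto
    have "cyl x m \<inter> (V M \<union> - cyl z n) \<noteq> {}" for x m
    proof (cases "cyl x m \<subseteq> cyl z n")
      case True
      obtain x' where x': "x' \<in> cyl x m" "x' \<in> G" using dense_G by blast
      have "\<not> tail_small E x' (max n m) (max M M0) c"
        using neg x' True by (meson IntI max.cobounded1 max.cobounded2 subsetD)
      then obtain y N where y: "y \<in> cyl x' (max n m)" "y \<in> G" "c < ds (max M M0) N (f y) (f (flip E y))"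
        unfolding tail_small_def by (meson IntD1 IntD2 not_le)
      then have less: "c < ds M N (f y) (f (flip E y))"
        using ds_mono[of M "max M M0" N N "f y" "f (flip E y)"] by simp
      obtain p where p: "\<forall>y'\<in>cyl y p \<inter> G. \<forall>k<N. f y' k = f y k \<and> f (flip E y') k = f (flip E y) k"
        using continuous_upto_flip[OF y(2) E] by blast
      have "ds M N (f y') (f (flip E y')) = ds M N (f y) (f (flip E y))" if "y' \<in> cyl y p \<inter> G" for y'
        using p that by (intro ds_cong) auto
      then have "y \<in> V M" unfolding V_def using less by (intro CollectI exI[of _ N] exI[of _ p]) simp
      moreover have "y \<in> cyl x m" using y(1) cyl_subset[OF x'(1), of "max n m"] by auto
      ultimately show ?thesis by blast
    qed auto
    then show "closure (V M \<union> - cyl z n) = UNIV" unfolding dense_iff_cyl by blast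
  qed
  let ?\<W> = "range W \<union> range (\<lambda>M. V M \<union> - cyl z n)"
  have "\<exists>x\<in>cyl z n. \<forall>S\<in>?\<W>. x \<in> S"
    by (rule Baire_cyl) (auto simp del: closure_Un simp: V open_W dense_W)
  then obtain x where x: "x \<in> cyl z n" "\<forall>S\<in>?\<W>. x \<in> S" by blast
  have xG: "x \<in> G" unfolding G_def using x(2) by blast
  have "E2 (f x) (f (flip E x))" using reduction E2_flip_finite[OF E] by blast
  then obtain M where M: "\<And>N. ds M N (f x) (f (flip E x)) \<le> c" using E2_tail[OF _ c] by meson
  have "V M \<union> - cyl z n \<in> ?\<W>" by simp
  with x(2) have "x \<in> V M \<union> - cyl z n" by (rule bspec)
  with x(1) have "x \<in> V M" by simp
  then obtain N p where "\<forall>y\<in>cyl x p \<inter> G. c < ds M N (f y) (f (flip E y))" unfolding V_def by blast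
  then have "c < ds M N (f x) (f (flip E x))" using xG by simp
  then show False using M[of N] by simp
qed

text \<open>
  The stages fix longer and longer initial segments \<open>z\<close> of \<open>x\<close>, and the set \<open>E\<close> of digits at which the
  partner of \<open>x\<close> differs from it; \<open>tail_small\<close> keeps what happens at one stage from being spoiled by
  the modifications of the earlier ones.
\<close>

lemma fusion:
  fixes Q :: "nat \<Rightarrow> nat set \<Rightarrow> bool"
  assumes z0: "z0 \<in> G" and c: "0 \<le> c"
    and local: "\<And>M M' a b a' b'. R M M' a b \<Longrightarrow> \<forall>k<M'. a k = a' k \<and> b k = b' k \<Longrightarrow> R M M' a' b'"
    and step: "\<And>k z n E M. z \<in> cyl z0 n0 \<Longrightarrow> n0 \<le> n \<Longrightarrow> z \<in> G \<Longrightarrow> E \<subseteq> {..<n} \<Longrightarrow> tail_small E z n M c \<Longrightarrow>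
       \<exists>z'\<in>cyl z n \<inter> G. \<exists>n'\<ge>n. \<exists>F M'. F \<subseteq> {n..<n'} \<and> M < M' \<and> tail_small (E \<union> F) z' n' M' c \<and> Q k F \<and>
         (\<forall>y\<in>cyl z' n' \<inter> G. R M M' (f y) (f (flip (E \<union> F) y)))"
  shows "\<exists>x F M. strict_mono M \<and> (\<forall>k. Q k (F k)) \<and>
     (\<forall>k::nat. R (M k) (M (Suc k)) (f x) (f (flip (\<Union>k. F k) x)))"
proof -
  let ?P = "\<lambda>k::nat. \<lambda>(z, n, E, M). z \<in> cyl z0 n0 \<and> n0 \<le> n \<and> z \<in> G \<and> E \<subseteq> {..<n} \<and> tail_small E z n M c \<and> (k = 0 \<longrightarrow> E = {})"
  \<comment> \<open>The inclusions in \<open>W k\<close> put both limit points into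
    \<open>G\<close>. Fixing the first \<open>M'\<close> digits of both values lets
    \<open>R\<close>, which by \<open>local\<close> depends on nothing else, pass from this stage to
    the limit.\<close>
  let ?S = "\<lambda>k. \<lambda>(z, n, E, M) (z', n', E', M'). z' \<in> cyl z n \<and> n < n' \<and> M < M' \<and>
     (\<exists>F\<subseteq>{n..}. E' = E \<union> F \<and> Q k F) \<and> cyl z' n' \<subseteq> W k \<and> cyl (flip E' z') n' \<subseteq> W k \<and>
     (\<forall>y\<in>cyl z' n' \<inter> G. \<forall>k<M'. f y k = f z' k) \<and>
     (\<forall>y\<in>cyl (flip E' z') n' \<inter> G. \<forall>k<M'. f y k = f (flip E' z') k) \<and>
     R M M' (f z') (f (flip E' z'))"
  have "\<exists>h. \<forall>k. ?P k (h k) \<and> ?S k (h k) (h (Suc k))"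
  proof (rule dependent_nat_choice)
    have "tail_small {} z0 n0 0 c" using c unfolding tail_small_def by simp
    then show "\<exists>s. ?P 0 s" using z0 by (intro exI[of _ "(z0, n0, {}, 0)"]) simp
    fix s k assume P: "?P k s"
    obtain z n E M where s: "s = (z, n, E, M)" by (metis prod_cases4)
    have z: "z \<in> cyl z0 n0" "n0 \<le> n" "z \<in> G" "E \<subseteq> {..<n}" "tail_small E z n M c" using P unfolding s by auto
    from step[OF this, of k] obtain z' n' F M' where z': "z' \<in> cyl z n" "z' \<in> G" "n \<le> n'" "F \<subseteq> {n..<n'}" "M < M'"
      "tail_small (E \<union> F) z' n' M' c" "Q k F" "\<forall>y\<in>cyl z' n' \<inter> G. R M M' (f y) (f (flip (E \<union> F) y))"
      by (elim bexE exE conjE IntE)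
    define E' where "E' = E \<union> F"
    have E': "finite E'" "E' \<subseteq> {..<n'}" using z(4) z'(3,4) unfolding E'_def by (auto intro: finite_subset)
    have g: "flip E' z' \<in> G" using flip_in z'(2) E'(1) by blast
    have "z' \<in> W k" "flip E' z' \<in> W k" using z'(2) g unfolding G_def by auto
    then obtain p1 p2 where p: "cyl z' p1 \<subseteq> W k" "cyl (flip E' z') p2 \<subseteq> W k"
      using open_contains_cyl[OF open_W] by meson
    obtain p3 where p3: "p3 \<ge> Suc n'" "\<forall>y\<in>cyl z' p3 \<inter> G. \<forall>k<M'. f y k = f z' k"
      using continuous_upto[OF z'(2)] by blast
    obtain p4 where p4: "p4 \<ge> p3" "\<forall>y\<in>cyl (flip E' z') p4 \<inter> G. \<forall>k<M'. f y k = f (flip E' z') k"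
      using continuous_upto[OF g] by blast
    define m where "m = max (max p1 p2) p4"
    have m: "n' < m" "n < m" "n0 \<le> m" using p3(1) p4(1) z'(3) z(2) by (auto simp: m_def)
    have le: "p1 \<le> m" "p2 \<le> m" "p3 \<le> m" "p4 \<le> m" using p4(1) by (auto simp: m_def)
    have c1: "cyl z' m \<subseteq> W k" using p(1) cyl_mono[OF le(1)] by (rule subset_trans[rotated])
    have c2: "cyl (flip E' z') m \<subseteq> W k" using p(2) cyl_mono[OF le(2)] by (rule subset_trans[rotated])
    have c3: "\<forall>y\<in>cyl z' m \<inter> G. \<forall>k<M'. f y k = f z' k"
      using p3(2) cyl_mono[OF le(3), of z'] by blast
    have c4: "\<forall>y\<in>cyl (flip E' z') m \<inter> G. \<forall>k<M'. f y k = f (flip E' z') k"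
      using p4(2) cyl_mono[OF le(4), of "flip E' z'"] by blast
    have "z' \<in> cyl z0 n0" using z'(1) cyl_subset[OF z(1,2)] by blast
    moreover have "E' \<subseteq> {..<m}" using E'(2) m by auto
    moreover have "tail_small E' z' m M' c"
      using tail_small_subcyl[OF z'(6) cyl_self less_imp_le[OF m(1)]] unfolding E'_def .
    ultimately have "?P (Suc k) (z', m, E', M')" using z'(2) m by simp
    moreover have R': "R M M' (f z') (f (flip E' z'))" using z'(2,8) unfolding E'_def by simp
    have "\<exists>F\<subseteq>{n..}. E' = E \<union> F \<and> Q k F" using z'(4,7) by (intro exI[of _ F]) (auto simp: E'_def)
    then have "?S k s (z', m, E', M')"
      using z'(1,5) m(2) c1 c2 c3 c4 R' unfolding s by simp
    ultimately show "\<exists>s'. ?P (Suc k) s' \<and> ?S k s s'" by (intro exI[of _ "(z', m, E', M')"] conjI)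
  qed
  then obtain h where h': "\<forall>k. ?P k (h k) \<and> ?S k (h k) (h (Suc k))" by (rule exE)
  have h: "?P k (h k)" "?S k (h k) (h (Suc k))" for k
    using conjunct1[OF spec[OF h']] conjunct2[OF spec[OF h']] .
  define z n E M where "z k = fst (h k)" and "n k = fst (snd (h k))" and "E k = fst (snd (snd (h k)))"
    and "M k = snd (snd (snd (h k)))" for k
  have hk: "h k = (z k, n k, E k, M k)" for k unfolding z_def n_def E_def M_def by simp
  have P: "E k \<subseteq> {..<n k}" for k using h(1)[of k] unfolding hk by simp
  have E0: "E 0 = {}" using h(1)[of 0] unfolding hk by simp
  have S: "z (Suc k) \<in> cyl (z k) (n k)" "n k < n (Suc k)" "M k < M (Suc k)"
     "\<exists>F\<subseteq>{n k..}. E (Suc k) = E k \<union> F \<and> Q k F"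
     "cyl (z (Suc k)) (n (Suc k)) \<subseteq> W k" "cyl (flip (E (Suc k)) (z (Suc k))) (n (Suc k)) \<subseteq> W k"
     "\<forall>y\<in>cyl (z (Suc k)) (n (Suc k)) \<inter> G. \<forall>l<M (Suc k). f y l = f (z (Suc k)) l"
     "\<forall>y\<in>cyl (flip (E (Suc k)) (z (Suc k))) (n (Suc k)) \<inter> G. \<forall>l<M (Suc k). f y l = f (flip (E (Suc k)) (z (Suc k))) l"
     "R (M k) (M (Suc k)) (f (z (Suc k))) (f (flip (E (Suc k)) (z (Suc k))))" for k
    using h(2)[of k] unfolding hk by simp_all
  obtain F where F: "\<And>k. F k \<subseteq> {n k..}" "\<And>k. E (Suc k) = E k \<union> F k" "\<And>k. Q k (F k)"
    using S(4) by metis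
  have mono_n: "strict_mono n" using S(2) by (simp add: strict_mono_Suc_iff)
  have nk: "k \<le> n k" for k using strict_mono_imp_increasing[OF mono_n] .
  have chain: "z b \<in> cyl (z a) (n a) \<and> E a \<subseteq> E b \<and> E b \<inter> {..<n a} \<subseteq> E a" if "a \<le> b" for a b
    using that
  proof (induction b rule: dec_induct)
    case (step b)
    have le: "n a \<le> n b" using mono_n step(1) by (simp add: strict_mono_less_eq)
    have "z (Suc b) \<in> cyl (z a) (n a)"
      using S(1)[of b] cyl_subset[of "z b" "z a" "n a" "n b"] le step.IH by blast
    moreover have "F b \<inter> {..<n a} = {}" using F(1)[of b] le by force
    ultimately show ?case using step.IH F(2)[of b] by blast
  qed simp
  \<comment> \<open>Digit \<open>i\<close> is settled by stage \<open>Suc i\<close> because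
    \<open>i < n (Suc i)\<close>.\<close>
  define x where "x = (\<lambda>i. z (Suc i) i)"
  define E' where "E' = (\<Union>k. F k)"
  have EF: "E' = (\<Union>k. E k)"
  proof
    show "E' \<subseteq> (\<Union>k. E k)" unfolding E'_def using F(2) by blast
    have "E k \<subseteq> E'" for k by (induction k) (auto simp: E0 F(2) E'_def)
    then show "(\<Union>k. E k) \<subseteq> E'" by blast
  qed
  have xk: "x \<in> cyl (z k) (n k)" for k
    unfolding cyl_def
  proof (intro CollectI allI impI)
    fix i assume i: "i < n k"
    show "x i = z k i"
    proof (cases "Suc i \<le> k")
      case True
      then show ?thesis using chain[OF True] nk[of "Suc i"] unfolding x_def cyl_def by auto
    next
      case False
      then show ?thesis using chain[of k "Suc i"] i unfolding x_def cyl_def by auto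
    qed
  qed
  have "i \<in> E' \<longleftrightarrow> i \<in> E k" if "i < n k" for i k
  proof
    assume "i \<in> E'"
    then obtain l where l: "i \<in> E l" unfolding EF by blast
    show "i \<in> E k" using chain[of l k] chain[of k l] l that by (cases "l \<le> k") auto
  qed (auto simp: EF)
  then have yk: "flip E' x \<in> cyl (flip (E k) (z k)) (n k)" for k
    using xk[of k] by (simp add: cyl_def flip_def)
  have xG: "x \<in> G" using xk S(5) unfolding G_def by blast
  have yG: "flip E' x \<in> G" using yk S(6) unfolding G_def by blast
  have "R (M k) (M (Suc k)) (f x) (f (flip E' x))" for k
    by (rule local[OF S(9)[of k]]) (use S(7,8)[of k] xk[of "Suc k"] yk[of "Suc k"] xG yG in auto)
  moreover have "strict_mono M" using S(3) by (simp add: strict_mono_Suc_iff)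
  ultimately show ?thesis using F(3) unfolding E'_def by blast
qed

end

text \<open>
  The initial part \<open>[M, B)\<close> is a buffer: since it is heavy and \<open>a\<close>, \<open>b\<close> nearly agree on it, no
  interval of almost total disagreement contains it.
\<close>

definition separated_block :: "nat \<Rightarrow> nat \<Rightarrow> cantor \<Rightarrow> cantor \<Rightarrow> bool" where
  "separated_block M M' a b \<longleftrightarrow> (\<exists>B. M \<le> B \<and> B \<le> M' \<and> 1 \<le> weight M B \<and> ds M B a b \<le> 1/10 \<and>
     9/10 \<le> ds M M' a b \<and> ds M M' a b \<le> 13/10)"

lemma separated_block_cong:
  assumes "separated_block M M' a b" "\<forall>k<M'. a k = a' k \<and> b k = b' k"
  shows "separated_block M M' a' b'"
proof -
  have "ds M B a b = ds M B a' b'" if "B \<le> M'" for B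
    using assms(2) that by (intro ds_cong) auto
  then show ?thesis using assms(1) unfolding separated_block_def by (metis order_refl)
qed

section \<open>Moving a value by a distance of about one\<close>

context generic_reduction
begin

text \<open>
  Otherwise infinitely many flips of weights \<open>1/2 ^ k\<close> can be fused into one \<open>E2\<close>-equivalent pair
  whose images are not \<open>E2\<close>-equivalent.
\<close>

lemma ex_small_flips:
  assumes z: "z \<in> G" and e: "0 < e"
  shows "\<exists>z'\<in>cyl z n \<inter> G. \<exists>n'\<ge>n. \<exists>d>0. \<exists>M. \<forall>y\<in>cyl z' n' \<inter> G. \<forall>F.
    finite F \<longrightarrow> F \<subseteq> {n'..} \<longrightarrow> (\<Sum>i\<in>F. 1 / (real i + 1)) \<le> d \<longrightarrow> (\<forall>N. ds M N (f y) (f (flip F y)) \<le> e)"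
proof (rule ccontr)
  assume neg: "\<not> ?thesis"
  have neg': "\<exists>y\<in>cyl z' n' \<inter> G. \<exists>F. finite F \<and> F \<subseteq> {n'..} \<and> (\<Sum>i\<in>F. 1 / (real i + 1)) \<le> d \<and>
      (\<exists>N. e < ds M N (f y) (f (flip F y)))" if "z' \<in> cyl z n" "z' \<in> G" "n \<le> n'" "0 < d" for z' n' d M
  proof (rule ccontr)
    assume "\<not> ?thesis"
    then have "\<forall>y\<in>cyl z' n' \<inter> G. \<forall>F. finite F \<longrightarrow> F \<subseteq> {n'..} \<longrightarrow> (\<Sum>i\<in>F. 1 / (real i + 1)) \<le> d \<longrightarrow>
      (\<forall>N. ds M N (f y) (f (flip F y)) \<le> e)" by (meson not_le)
    then show False using neg that by (meson IntI)
  qed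
  define Q where "Q k F \<longleftrightarrow> finite F \<and> (\<Sum>i\<in>F. 1 / (real i + 1)) \<le> (1/2) ^ k" for k :: nat and F :: "nat set"
  \<comment> \<open>A flip moves the value by more than \<open>e\<close>, and the flips
    \<open>E\<close> of the earlier stages can undo at most \<open>e / 2\<close> of this.\<close>
  define R where "R M M' a b \<longleftrightarrow> e / 2 \<le> ds M M' a b" for M M' a b
  have "\<exists>x F M. strict_mono M \<and> (\<forall>k. Q k (F k)) \<and>
     (\<forall>k::nat. R (M k) (M (Suc k)) (f x) (f (flip (\<Union>k. F k) x)))"
  proof (rule fusion[OF z, where c = "e / 2" and ?n0.0 = n])
    show "0 \<le> e / 2" using e by simp
    show "R M M' a' b'" if "R M M' a b" "\<forall>k<M'. a k = a' k \<and> b k = b' k" for M M' a b a' b'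
      using that ds_cong[of M M' a a' b b'] unfolding R_def by simp
    fix k z' m E M
    assume z': "z' \<in> cyl z n" "n \<le> m" "z' \<in> G" and E: "E \<subseteq> {..<m}" "tail_small E z' m M (e / 2)"
    obtain x F N where x: "x \<in> cyl z' m" "x \<in> G" and F: "finite F" "F \<subseteq> {m..}"
        "(\<Sum>i\<in>F. 1 / (real i + 1)) \<le> (1/2) ^ k" and N: "e < ds M N (f x) (f (flip F x))"
      using neg'[OF z'(1,3,2), of "(1/2) ^ k" M] by auto
    obtain p where p: "\<forall>i\<in>F. i < p" using F(1) unfolding finite_nat_set_iff_bounded by blast
    obtain q where q: "q \<ge> max m p" "\<forall>y\<in>cyl x q \<inter> G. \<forall>k<N. f y k = f x k \<and> f (flip F y) k = f (flip F x) k"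
      using continuous_upto_flip[OF x(2) F(1)] by blast
    have fin: "finite (E \<union> F)" using E(1) F(1) by (auto intro: finite_subset)
    \<comment> \<open>\<open>M'\<close> lies beyond \<open>N\<close>, so the block from
      \<open>M\<close> to \<open>M'\<close> keeps the whole move; the tail bound at
      \<open>M'\<close> is what the next stage starts from.\<close>
    obtain w r M' where w: "w \<in> cyl x q" "w \<in> G" "q \<le> r" "max N (Suc M) \<le> M'" "tail_small (E \<union> F) w r M' (e / 2)"
      using ex_tail_small[OF fin, of "e / 2" x q "max N (Suc M)"] e by auto
    have "R M M' (f y) (f (flip (E \<union> F) y))" if y: "y \<in> cyl w r" "y \<in> G" for y
    proof -
      have yq: "y \<in> cyl x q" using y(1) cyl_subset[OF w(1,3)] by blast
      then have ym: "y \<in> cyl z' m" using cyl_subset[OF x(1), of q] q(1) by auto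
      have "ds M N (f y) (f (flip F y)) = ds M N (f x) (f (flip F x))"
        using q(2) yq y(2) by (intro ds_cong) auto
      moreover have "ds M N (f (flip F y)) (f (flip E (flip F y))) \<le> e / 2"
        using tail_smallD[OF E(2) flip_in_cyl[OF F(2) ym]] flip_in[OF y(2)] F(1) by blast
      moreover have "E \<inter> F = {}" using E(1) F(2) by force
      ultimately have "e / 2 \<le> ds M N (f y) (f (flip (E \<union> F) y))"
        using N ds_triangle[of M N "f y" "f (flip F y)" "f (flip (E \<union> F) y)"]
          ds_commute[of M N "f (flip (E \<union> F) y)" "f (flip F y)"] by (simp add: flip_flip_disjoint)
      also have "\<dots> \<le> ds M M' (f y) (f (flip (E \<union> F) y))" using w(4) by (intro ds_mono) auto
      finally show ?thesis unfolding R_def .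
    qed
    then have "\<exists>F M'. F \<subseteq> {m..<r} \<and> M < M' \<and> tail_small (E \<union> F) w r M' (e / 2) \<and> Q k F \<and>
         (\<forall>y\<in>cyl w r \<inter> G. R M M' (f y) (f (flip (E \<union> F) y)))"
    proof (intro exI[of _ F] exI[of _ M'] conjI ballI)
      show "F \<subseteq> {m..<r}" using F(2) p q(1) w(3) by force
    qed (use w F in \<open>auto simp: Q_def\<close>)
    moreover have "w \<in> cyl z' m \<inter> G" using w(1,2) cyl_subset[OF x(1), of q] q(1) by auto
    moreover have "m \<le> r" using q(1) w(3) by simp
    ultimately show "\<exists>z''\<in>cyl z' m \<inter> G. \<exists>n'\<ge>m. \<exists>F M'. F \<subseteq> {m..<n'} \<and> M < M' \<and> tail_small (E \<union> F) z'' n' M' (e / 2) \<and> Q k F \<and>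
         (\<forall>y\<in>cyl z'' n' \<inter> G. R M M' (f y) (f (flip (E \<union> F) y)))"
      by (intro bexI[of _ w] exI[of _ r] conjI)
  qed
  then obtain x F M where x: "strict_mono M" "\<And>k. Q k (F k)"
    "\<And>k::nat. R (M k) (M (Suc k)) (f x) (f (flip (\<Union>k. F k) x))" by blast
  have "E2 x (flip (\<Union>k. F k) x)" using x(2) by (intro E2_flip_summable) (auto simp: Q_def)
  moreover have "\<not> E2 (f x) (f (flip (\<Union>k. F k) x))"
    by (rule not_E2_if_blocks[OF x(1), of "e / 2"]) (use e x(3) in \<open>auto simp: R_def\<close>)
  ultimately show False using reduction by blast
qed

text \<open>Flipping all digits from \<open>n\<close> on makes the values inequivalent, so they
  differ by more than 1 already before some \<open>N\<close>. Continuity at the flipped point allows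
  the flip to be cut off to a finite one without changing the first \<open>N\<close> digits of the
  value.\<close>

lemma ex_large_flip:
  assumes z: "z \<in> G"
  shows "\<exists>F. finite F \<and> F \<subseteq> {n..} \<and> (\<exists>N. 1 < ds M N (f z) (f (flip F z)))"
proof -
  let ?y = "flip {n..} z"
  have y: "?y \<in> G" by (rule flip_in[OF z]) (simp add: Compl_atLeast)
  have "\<not> E2 (f z) (f ?y)" using not_E2_flip_atLeast reduction by blast
  then obtain N where N: "1 < ds M N (f z) (f ?y)" using not_E2_tail_unbounded by blast
  obtain p where p: "\<forall>x\<in>cyl ?y p \<inter> G. \<forall>k<N. f x k = f ?y k" using continuous_upto[OF y] by blast
  let ?F = "{n..<p}"
  have "flip ?F z \<in> cyl ?y p" by (auto simp: cyl_def flip_def)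
  moreover have "flip ?F z \<in> G" using flip_in[OF z] by blast
  ultimately have "ds M N (f z) (f (flip ?F z)) = ds M N (f z) (f ?y)" using p by (intro ds_cong) auto
  then have "1 < ds M N (f z) (f (flip ?F z))" using N by simp
  moreover have "finite ?F \<and> ?F \<subseteq> {n..}" by auto
  ultimately show ?thesis by blast
qed

text \<open>
  A set \<open>F\<close> of least size that moves the image of some point by more than 1: removing one element of
  \<open>F\<close> brings the distance down to at most 1 at all points of the cylinder, and putting it back
  adds at most \<open>e\<close>.
\<close>

lemma ex_unit_flip:
  assumes z: "z \<in> G" and e: "0 < e"
  shows "\<exists>z'\<in>cyl z n \<inter> G. \<exists>n'\<ge>n. \<exists>F\<subseteq>{n..<n'}. \<exists>M\<ge>M0. \<exists>N.
    (\<forall>y\<in>cyl z' n' \<inter> G. (\<forall>k<M. f (flip F y) k = f y k) \<and> 1 < ds M N (f y) (f (flip F y)) \<and>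
       (\<forall>N'. ds M N' (f y) (f (flip F y)) \<le> 1 + e))"
proof -
  obtain z1 n1 d M1 where z1': "z1 \<in> cyl z n \<inter> G" "n \<le> n1" "0 < d" and small': "\<forall>y\<in>cyl z1 n1 \<inter> G. \<forall>F.
      finite F \<longrightarrow> F \<subseteq> {n1..} \<longrightarrow> (\<Sum>i\<in>F. 1 / (real i + 1)) \<le> d \<longrightarrow> (\<forall>N. ds M1 N (f y) (f (flip F y)) \<le> e)"
    using ex_small_flips[OF assms, of n] by (elim bexE exE conjE)
  from z1' have z1: "z1 \<in> cyl z n" "z1 \<in> G" "n \<le> n1" "0 < d" by auto
  have small: "ds M1 N (f y) (f (flip F y)) \<le> e"
    if "y \<in> cyl z1 n1" "y \<in> G" "finite F" "F \<subseteq> {n1..}" "(\<Sum>i\<in>F. 1 / (real i + 1)) \<le> d" for y F N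
    using small' that by simp
  define M where "M = max M0 M1"
  obtain m where m: "1 / d < real m" using reals_Archimedean2 by blast
  \<comment> \<open>Digits from \<open>m\<close> on weigh at most \<open>d\<close>, so each of them
    alone is a small flip. Fixing the first \<open>M\<close> digits of the value makes the agreement
    below \<open>M\<close> exact.\<close>
  obtain n2 where n2: "n2 \<ge> max n1 m" "\<forall>y\<in>cyl z1 n2 \<inter> G. \<forall>k<M. f y k = f z1 k"
    using continuous_upto[OF z1(2)] by blast
  have single: "ds M N (f y) (f (flip {i} y)) \<le> e" if "y \<in> cyl z1 n2" "y \<in> G" "n2 \<le> i" for y i N
  proof -
    have "1 / d < real i + 1" using m that(3) n2(1) by simp
    then have "1 / (real i + 1) \<le> d" using z1(4) by (simp add: field_simps)
    moreover have "y \<in> cyl z1 n1" using that(1) n2(1) cyl_mono[of n1 n2 z1] by auto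
    ultimately have "ds M1 N (f y) (f (flip {i} y)) \<le> e" using that n2(1) by (intro small) auto
    then show ?thesis using ds_mono[of M1 M N N "f y" "f (flip {i} y)"] by (simp add: M_def)
  qed
  define P where "P F \<longleftrightarrow> finite F \<and> F \<subseteq> {n2..} \<and> (\<exists>y\<in>cyl z1 n2 \<inter> G. \<exists>N. 1 < ds M N (f y) (f (flip F y)))" for F
  have "\<exists>F. P F" using ex_large_flip[OF z1(2), of n2 M] z1(2) cyl_self[of z1 n2] unfolding P_def by blast
  then obtain F where F: "P F" and min: "\<And>F'. P F' \<Longrightarrow> card F \<le> card F'"
    using ex_has_least_nat[of P _ card] by blast
  then obtain x N where x: "x \<in> cyl z1 n2" "x \<in> G" "1 < ds M N (f x) (f (flip F x))" and fin: "finite F" "F \<subseteq> {n2..}"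
    unfolding P_def by blast
  have upper: "ds M N' (f y) (f (flip F y)) \<le> 1 + e" if y: "y \<in> cyl z1 n2" "y \<in> G" for y N'
  proof -
    have "F \<noteq> {}" using x(3) by auto
    then obtain i where i: "i \<in> F" by blast
    have "card (F - {i}) < card F" using i fin(1) by (intro psubset_card_mono) auto
    then have "\<not> P (F - {i})" using min by (meson not_le)
    then have "ds M N' (f y) (f (flip (F - {i}) y)) \<le> 1" using y fin unfolding P_def by (meson Diff_subset IntI finite_Diff not_le order_trans)
    moreover have "flip (F - {i}) y \<in> cyl z1 n2" using fin(2) y(1) by (intro flip_in_cyl) auto
    moreover have "flip (F - {i}) y \<in> G" using flip_in[OF y(2)] fin(1) by blast
    moreover have "flip {i} (flip (F - {i}) y) = flip F y"
      using i by (subst flip_flip_disjoint) (auto simp: insert_absorb)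
    ultimately show ?thesis
      using ds_triangle[of M N' "f y" "f (flip F y)" "f (flip (F - {i}) y)"]
        single[of "flip (F - {i}) y" i N'] i fin(2) by auto
  qed
  obtain p where p: "\<forall>i\<in>F. i < p" using fin(1) unfolding finite_nat_set_iff_bounded by blast
  obtain q where q: "q \<ge> max n2 p" "\<forall>y\<in>cyl x q \<inter> G. \<forall>k<N. f y k = f x k \<and> f (flip F y) k = f (flip F x) k"
    using continuous_upto_flip[OF x(2) fin(1)] by blast
  have "(\<forall>k<M. f (flip F y) k = f y k) \<and> 1 < ds M N (f y) (f (flip F y)) \<and>
      (\<forall>N'. ds M N' (f y) (f (flip F y)) \<le> 1 + e)" if y: "y \<in> cyl x q \<inter> G" for y
  proof (intro conjI)
    have yz: "y \<in> cyl z1 n2" using y cyl_subset[OF x(1), of q] q(1) by auto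
    then have "flip F y \<in> cyl z1 n2" using fin(2) by (intro flip_in_cyl)
    moreover have "flip F y \<in> G" using flip_in[of y F] y fin(1) by blast
    ultimately show "\<forall>k<M. f (flip F y) k = f y k" using n2(2) yz y by auto
    have "ds M N (f y) (f (flip F y)) = ds M N (f x) (f (flip F x))" using q(2) y by (intro ds_cong) auto
    then show "1 < ds M N (f y) (f (flip F y))" using x(3) by simp
    show "\<forall>N'. ds M N' (f y) (f (flip F y)) \<le> 1 + e" using upper yz y by blast
  qed
  moreover have "x \<in> cyl z n \<inter> G" using x(1,2) cyl_subset[OF z1(1), of n2] z1(3) n2(1) by auto
  moreover have "n \<le> q" using z1(3) n2(1) q(1) by simp
  moreover have "F \<subseteq> {n..<q}" using fin(2) p q(1) z1(3) n2(1) by force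
  moreover have "M0 \<le> M" by (simp add: M_def)
  ultimately show ?thesis by meson
qed

text \<open>No weight condition is put on the flips: here the partner is meant to become
  inequivalent, so \<open>Q\<close> is trivial and everything is asked of the values.\<close>

lemma ex_separated_blocks:
  "\<exists>x x' M. strict_mono M \<and> (\<forall>k::nat. separated_block (M k) (M (Suc k)) (f x) (f x'))"
proof -
  obtain z0 where z0: "z0 \<in> G" using dense_G by blast
  have "\<exists>x (F :: nat \<Rightarrow> nat set) M. strict_mono M \<and> (\<forall>k::nat. True) \<and>
     (\<forall>k::nat. separated_block (M k) (M (Suc k)) (f x) (f (flip (\<Union>k. F k) x)))"
  proof (rule fusion[OF z0, where c = "1/10" and ?n0.0 = 0 and Q = "\<lambda>_ _. True"
        and R = separated_block])
    show "separated_block M M' a' b'" if "separated_block M M' a b" "\<forall>k<M'. a k = a' k \<and> b k = b' k" for M M' a b a' b'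
      using that by (rule separated_block_cong)
    fix k z n E M
    assume z: "z \<in> G" and E: "E \<subseteq> {..<n}" "tail_small E z n M (1/10)"
    \<comment> \<open>The buffer is fixed before the new flip is chosen. That flip leaves the value
      unchanged below \<open>M2 \<ge> B\<close>, so on the buffer only the earlier flips
      \<open>E\<close> contribute.\<close>
    obtain B where B: "M < B" "1 < weight M B" using weight_unbounded by blast
    have "(0::real) < 1/10" by simp
    from ex_unit_flip[OF z this, of n B] obtain x q F M2 N where x': "x \<in> cyl z n \<inter> G" "n \<le> q" "F \<subseteq> {n..<q}" "B \<le> M2"
      and F': "\<forall>y\<in>cyl x q \<inter> G. (\<forall>k<M2. f (flip F y) k = f y k) \<and> 1 < ds M2 N (f y) (f (flip F y)) \<and>
       (\<forall>N'. ds M2 N' (f y) (f (flip F y)) \<le> 1 + 1/10)"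
      by (elim bexE exE conjE)
    from x' have x: "x \<in> cyl z n" "x \<in> G" "n \<le> q" "F \<subseteq> {n..<q}" "B \<le> M2" by auto
    have F: "\<forall>k<M2. f (flip F y) k = f y k" "1 < ds M2 N (f y) (f (flip F y))"
      "ds M2 N' (f y) (f (flip F y)) \<le> 1 + 1/10" if "y \<in> cyl x q" "y \<in> G" for y N'
      using bspec[OF F' IntI[OF that]] by blast+
    have fin: "finite F" "finite (E \<union> F)" using E(1) x(4) by (auto intro: finite_subset)
    obtain w r M' where w: "w \<in> cyl x q" "w \<in> G" "q \<le> r" "max N M2 \<le> M'" "tail_small (E \<union> F) w r M' (1/10)"
      using ex_tail_small[OF fin(2), of "1/10" x q "max N M2"] by auto
    have "separated_block M M' (f y) (f (flip (E \<union> F) y))" if y: "y \<in> cyl w r" "y \<in> G" for y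
    proof -
      have yq: "y \<in> cyl x q" using y(1) cyl_subset[OF w(1,3)] by blast
      then have yn: "y \<in> cyl z n" using cyl_subset[OF x(1,3)] by blast
      have "E \<inter> F = {}" using E(1) x(4) by force
      moreover have "ds M N' (f (flip F y)) (f (flip E (flip F y))) \<le> 1/10" for N'
        by (rule tail_smallD[OF E(2)]) (use x(4) yn y(2) flip_in fin in \<open>auto intro!: flip_in_cyl\<close>)
      ultimately have tail: "ds M N' (f (flip F y)) (f (flip (E \<union> F) y)) \<le> 1/10" for N'
        by (simp add: flip_flip_disjoint)
      have zero: "ds M N' (f y) (f (flip F y)) = 0" if "N' \<le> M2" for N'
      proof -
        have "ds M N' (f y) (f (flip F y)) = ds M N' (f y) (f y)"
          using F(1)[OF yq y(2)] that by (intro ds_cong) auto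
        then show ?thesis by simp
      qed
      have "ds M M' (f y) (f (flip F y)) = ds M M2 (f y) (f (flip F y)) + ds M2 M' (f y) (f (flip F y))"
        using B(1) x(5) w(4) by (intro ds_split) auto
      then have mid: "ds M M' (f y) (f (flip F y)) = ds M2 M' (f y) (f (flip F y))" using zero by simp
      have "1 < ds M2 N (f y) (f (flip F y))" using F(2)[OF yq y(2)] .
      also have "\<dots> \<le> ds M2 M' (f y) (f (flip F y))" using w(4) by (intro ds_mono) auto
      finally have low: "1 < ds M M' (f y) (f (flip F y))" unfolding mid .
      have up: "ds M M' (f y) (f (flip F y)) \<le> 1 + 1/10" unfolding mid using F(3)[OF yq y(2)] .
      \<comment> \<open>Past \<open>M\<close>, the flips \<open>E\<close> contribute at most 1/10.
        The move by \<open>F\<close> alone lies between 1 and 11/10, so the combined distance lies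
        between 9/10 and 12/10.\<close>
      have "ds M B (f y) (f (flip (E \<union> F) y)) \<le> 1/10"
        using ds_triangle[of M B "f y" "f (flip (E \<union> F) y)" "f (flip F y)"] tail[of B] zero[OF x(5)] by simp
      moreover have "9/10 \<le> ds M M' (f y) (f (flip (E \<union> F) y))"
        using ds_triangle[of M M' "f y" "f (flip F y)" "f (flip (E \<union> F) y)"] tail[of M'] low
          ds_commute[of M M' "f (flip (E \<union> F) y)" "f (flip F y)"] by simp
      moreover have "ds M M' (f y) (f (flip (E \<union> F) y)) \<le> 13/10"
        using ds_triangle[of M M' "f y" "f (flip (E \<union> F) y)" "f (flip F y)"] tail[of M'] up by simp
      ultimately show ?thesis unfolding separated_block_def
        by (intro exI[of _ B]) (use B x(5) w(4) in auto)
    qed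
    then have "\<exists>F M'. F \<subseteq> {n..<r} \<and> M < M' \<and> tail_small (E \<union> F) w r M' (1/10) \<and> True \<and>
         (\<forall>y\<in>cyl w r \<inter> G. separated_block M M' (f y) (f (flip (E \<union> F) y)))"
    proof (intro exI[of _ F] exI[of _ M'] conjI ballI)
      show "F \<subseteq> {n..<r}" using x(4) w(3) by force
    qed (use x w B in auto)
    moreover have "w \<in> cyl z n \<inter> G" using w(1,2) cyl_subset[OF x(1,3)] by blast
    moreover have "n \<le> r" using x(3) w(3) by simp
    ultimately show "\<exists>z'\<in>cyl z n \<inter> G. \<exists>n'\<ge>n. \<exists>F M'. F \<subseteq> {n..<n'} \<and> M < M' \<and> tail_small (E \<union> F) z' n' M' (1/10) \<and>
        True \<and> (\<forall>y\<in>cyl z' n' \<inter> G. separated_block M M' (f y) (f (flip (E \<union> F) y)))"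
      by (intro bexI[of _ w] exI[of _ r] conjI)
  qed auto
  then show ?thesis by blast
qed

end

text \<open>A run of total disagreement between \<open>a\<close> and \<open>y\<close> that starts in
  block \<open>k\<close> ends inside the buffer of block \<open>k + 1\<close>: on the whole buffer
  \<open>a\<close> and \<open>b\<close> would be both close and, through \<open>y\<close>, almost
  fully apart. The distance of \<open>a\<close> and \<open>b\<close> on the run is thus at most
  13/10 + 1/10, while a run heavier than 3 would force it above 29/10.\<close>

lemma separated_blocks_notin_C:
  assumes M: "strict_mono (M :: nat \<Rightarrow> nat)"
    and block: "\<And>k. separated_block (M k) (M (Suc k)) a b" and "E2 b y"
  shows "(a, y) \<notin> C"
proof -
  obtain N where N: "\<And>n. ds N n b y \<le> 1/10" using E2_tail[OF \<open>E2 b y\<close>, of "1/10"] by auto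
  let ?n = "max N (M 0)"
  have "False" if ij: "?n \<le> i" "3 < weight i j" and ne: "\<forall>k. i \<le> k \<and> k < j \<longrightarrow> a k \<noteq> y k" for i j
  proof -
    have agree: "weight p q - ds p q a b \<le> 1/10" if "i \<le> p" "q \<le> j" for p q
    proof -
      have "weight p q - ds p q a b = ds p q y b"
        unfolding ds_flip_left[symmetric] using ne that by (intro ds_cong) auto
      also have "\<dots> \<le> ds N q b y" unfolding ds_commute[of _ _ y b] using that ij(1) by (intro ds_mono) auto
      also have "\<dots> \<le> 1/10" by (rule N)
      finally show ?thesis .
    qed
    have "\<exists>k. M k \<le> i \<and> i < M (Suc k)"
    proof -
      have bd: "\<And>k. M k \<le> i \<Longrightarrow> k \<le> i" using strict_mono_imp_increasing[OF M] order_trans by blast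
      have M0: "M 0 \<le> i" using ij(1) by simp
      let ?k = "GREATEST k. M k \<le> i"
      have "M ?k \<le> i" by (rule GreatestI_nat[of "\<lambda>k. M k \<le> i", OF M0 bd])
      moreover have "i < M (Suc ?k)"
        using Greatest_le_nat[of "\<lambda>k. M k \<le> i" "Suc ?k" i] bd by (metis Suc_n_not_le_n not_le)
      ultimately show ?thesis by blast
    qed
    then obtain k where k: "M k \<le> i" "i < M (Suc k)" by blast
    obtain B where B: "M (Suc k) \<le> B" "1 \<le> weight (M (Suc k)) B" "ds (M (Suc k)) B a b \<le> 1/10"
      using block[of "Suc k"] unfolding separated_block_def by blast
    have up: "ds (M k) (M (Suc k)) a b \<le> 13/10" using block[of k] unfolding separated_block_def by blast
    have "j < B"
    proof (rule ccontr)
      assume "\<not> j < B"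
      then have "weight (M (Suc k)) B - ds (M (Suc k)) B a b \<le> 1/10" using k by (intro agree) auto
      then show False using B by simp
    qed
    then have "ds i j a b \<le> ds (M k) B a b" using k by (intro ds_mono) auto
    also have "\<dots> = ds (M k) (M (Suc k)) a b + ds (M (Suc k)) B a b" using k B by (intro ds_split) auto
    finally show False using up B(3) agree[of i j] ij(2) by simp
  qed
  then have "(a, y) \<notin> D ?n" unfolding in_D_iff by blast
  then show ?thesis unfolding C_def by blast
qed

section \<open>Reductions of E2\<close>

text \<open>Each digit of \<open>f\<close> is a set with the Baire property. Invariance under flips
  is obtained by adding the preimages of the dense open sets under all flips by finite or cofinite
  sets: there are countably many, they are homeomorphisms, and symmetric differences keep the family
  closed under composition.\<close>

lemma ex_generic_reduction:
  assumes f: "is_reduction E2 UNIV E2 B f"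
  shows "\<exists>W. generic_reduction W f"
proof -
  have red: "E2 (f x) (f y) \<longleftrightarrow> E2 x y" for x y using f unfolding is_reduction_def by blast
  have "\<exists>\<V>. decided_on \<V> {x. f x k}" for k
  proof -
    have "open {y :: cantor. y k}"
      unfolding open_iff_cyl by (intro ballI exI[of _ "Suc k"]) (auto simp: cyl_def)
    then obtain S where "Delta11 S" "f -` {y. y k} \<inter> UNIV = S \<inter> UNIV"
      using f unfolding is_reduction_def Delta11_on_def by meson
    then have "Delta11 {x. f x k}" by (simp add: vimage_def)
    then show ?thesis using Delta11_baire_property unfolding baire_property_def by blast
  qed
  then obtain \<V> where \<V>: "\<And>k. decided_on (\<V> k) {x. f x k}" by metis
  define Fs where "Fs = {F :: nat set. finite F \<or> finite (- F)}"
  \<comment> \<open>\<open>UNIV\<close> makes the family nonempty, so that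
    \<open>from_nat_into\<close> enumerates exactly its members.\<close>
  define \<W> where "\<W> = insert UNIV (\<Union>F\<in>Fs. \<Union>k. (\<lambda>S. flip F -` S) ` \<V> k)"
  have "countable Fs"
  proof -
    have "Fs \<subseteq> Collect finite \<union> uminus ` Collect finite" unfolding Fs_def by (force simp: image_iff)
    then show ?thesis by (rule countable_subset) (simp add: countable_Collect_finite)
  qed
  then have "countable \<W>" using \<V> unfolding \<W>_def decided_on_def by auto
  then have W: "range (from_nat_into \<W>) = \<W>" by (intro range_from_nat_into) (simp_all add: \<W>_def)
  have \<V>': "open S" "closure S = UNIV" if "S \<in> \<V> k" for S k
    using \<V>[of k] that unfolding decided_on_def by simp_all
  have flip_vimage: "open (flip F -` S) \<and> closure (flip F -` S) = UNIV" if S: "open S" "closure S = UNIV" for F S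
  proof
    show "open (flip F -` S)" unfolding open_iff_cyl
    proof
      fix x assume "x \<in> flip F -` S"
      then obtain n where "cyl (flip F x) n \<subseteq> S" using open_contains_cyl[OF S(1)] by blast
      then have "cyl x n \<subseteq> flip F -` S" using flip_cyl_flip by blast
      then show "\<exists>n. cyl x n \<subseteq> flip F -` S" ..
    qed
    have "cyl x n \<inter> flip F -` S \<noteq> {}" for x n
    proof -
      obtain y where y: "y \<in> cyl (flip F x) n" "y \<in> S" using S(2) unfolding dense_iff_cyl by blast
      have "flip F (flip F z) = z" for z by (simp add: flip_flip)
      then have "flip F y \<in> cyl x n" "flip F y \<in> flip F -` S"
        using flip_cyl_flip[OF y(1), of F] y(2) by simp_all
      then show ?thesis by blast
    qed
    then show "closure (flip F -` S) = UNIV" unfolding dense_iff_cyl by blast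
  qed
  have \<W>: "open S \<and> closure S = UNIV" if "S \<in> \<W>" for S
    using that \<V>' flip_vimage unfolding \<W>_def by fastforce
  have G: "x \<in> \<Inter>\<W> \<longleftrightarrow> (\<forall>F\<in>Fs. \<forall>k. \<forall>S\<in>\<V> k. flip F x \<in> S)" for x
    unfolding \<W>_def by auto
  have range_W: "(\<Inter>n. from_nat_into \<W> n) = \<Inter>\<W>" using W by simp
  have "generic_reduction (from_nat_into \<W>) f"
  proof (unfold_locales; (unfold range_W)?)
    show "open (from_nat_into \<W> n)" "closure (from_nat_into \<W> n) = UNIV" for n
      using \<W> W by (metis rangeI)+
    show "flip F x \<in> \<Inter>\<W>" if x: "x \<in> \<Inter>\<W>" and F: "finite F \<or> finite (- F)" for x F
      unfolding G
    proof (intro ballI allI)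
      fix F' k S assume "F' \<in> Fs" "S \<in> \<V> k"
      have "(F' - F) \<union> (F - F') \<in> Fs"
      proof (cases "finite F = finite F'")
        case True
        then have "finite ((F' - F) \<union> (F - F'))"
          using F \<open>F' \<in> Fs\<close> unfolding Fs_def
          by (metis (mono_tags, lifting) Diff_eq double_compl finite_Diff finite_Int finite_Un mem_Collect_eq inf_commute)
        then show ?thesis unfolding Fs_def by blast
      next
        case False
        have "- ((F' - F) \<union> (F - F')) \<subseteq> (if finite F then F \<union> - F' else F' \<union> - F)" by auto
        moreover have "finite (if finite F then F \<union> - F' else F' \<union> - F)"
          using False F \<open>F' \<in> Fs\<close> unfolding Fs_def by auto
        ultimately show ?thesis unfolding Fs_def using finite_subset by blast
      qed
      then show "flip F' (flip F x) \<in> S" using x \<open>S \<in> \<V> k\<close> unfolding G flip_flip by blast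
    qed
    show "\<exists>n. \<forall>y\<in>cyl x n \<inter> \<Inter>\<W>. f y k = f x k" if x: "x \<in> \<Inter>\<W>" for x k
    proof -
      have "{} \<in> Fs" unfolding Fs_def by simp
      then have sub: "\<Inter>\<W> \<subseteq> \<Inter>(\<V> k)" using G by fastforce
      obtain U where U: "open U" "x \<in> U" "U \<inter> \<Inter>(\<V> k) \<subseteq> {x. f x k} \<or> U \<inter> \<Inter>(\<V> k) \<subseteq> - {x. f x k}"
        using decided_onD[OF \<V>[of k], of x] x sub by (meson subsetD)
      obtain n where n: "cyl x n \<subseteq> U" using open_contains_cyl U(1,2) by blast
      have "y \<in> U \<inter> \<Inter>(\<V> k)" if "y \<in> cyl x n" "y \<in> \<Inter>\<W>" for y using that n sub by (meson IntI subsetD)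
      then have in_U: "y \<in> U \<inter> \<Inter>(\<V> k)" if "y \<in> cyl x n \<inter> \<Inter>\<W>" for y using that by simp
      have x': "x \<in> U \<inter> \<Inter>(\<V> k)" using in_U[of x] x by simp
      have "\<forall>y\<in>cyl x n \<inter> \<Inter>\<W>. f y k = f x k"
        using U(3)
      proof
        assume A: "U \<inter> \<Inter>(\<V> k) \<subseteq> {x. f x k}"
        show ?thesis using subsetD[OF A in_U] subsetD[OF A x'] by simp
      next
        assume A: "U \<inter> \<Inter>(\<V> k) \<subseteq> - {x. f x k}"
        show ?thesis using subsetD[OF A in_U] subsetD[OF A x'] by simp
      qed
      then show ?thesis by blast
    qed
  qed (rule red)
  then show ?thesis by blast
qed

text \<open>The inclusion of saturations is applied at the partner \<open>f x'\<close>. Nothing is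
  known of the resulting \<open>y\<close> beyond its equivalence to \<open>f x'\<close>; the block
  estimates tolerate the error in the tail.\<close>

lemma prod_E2_not_subset_C:
  assumes "reducible E2 UNIV E2 B0" "saturation E2 B0 \<subseteq> saturation E2 B1"
  shows "\<not> prod_E2 B0 B1 \<subseteq> C"
proof -
  obtain f where f: "is_reduction E2 UNIV E2 B0 f" using assms(1) unfolding reducible_def by blast
  then obtain W where "generic_reduction W f" using ex_generic_reduction by blast
  then interpret generic_reduction W f "\<Inter>n. W n" by simp
  obtain x x' M where M: "strict_mono M" "\<And>k::nat. separated_block (M k) (M (Suc k)) (f x) (f x')"
    using ex_separated_blocks by blast
  have B0: "f x \<in> B0" "f x' \<in> B0" using f unfolding is_reduction_def by auto
  have "E2 (f x') (f x')" by (auto simp: E2_iff_ds)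
  then have "f x' \<in> saturation E2 B1" using B0(2) assms(2) unfolding saturation_def by blast
  then obtain y where y: "y \<in> B1" "E2 y (f x')" unfolding saturation_def by blast
  have "9/10 \<le> ds (M k) (M (Suc k)) (f x) (f x')" for k using M(2)[of k] unfolding separated_block_def by blast
  then have "\<not> E2 (f x) (f x')" by (intro not_E2_if_blocks[OF M(1), of "9/10"]) auto
  then have "(f x, y) \<in> prod_E2 B0 B1" using B0(1) y E2_trans unfolding prod_E2_def by blast
  moreover have "(f x, y) \<notin> C" using separated_blocks_notin_C[OF M E2_sym[OF y(2)]] .
  ultimately show ?thesis by blast
qed

theorem theorem15p2:
  shows
  "(\<forall>n. open (D n) \<and> closure (D n) = UNIV) \<and> comeager_in euclidean C
   \<and>
   (\<forall>(z :: cantor) (X :: nat \<Rightarrow> cantor set) (m :: nat \<Rightarrow> nat) (g :: nat \<Rightarrow> bool list \<Rightarrow> bool list).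
      (\<forall>i<2. lightface_Sigma11 z (X i)) \<and>
      strict_mono m \<and>
      (\<forall>i<2. \<forall>k s. length s = k \<longrightarrow> length (g i s) = m k) \<and>
      (\<forall>i<2. \<forall>s t. prefix s t \<longrightarrow> prefix (g i s) (g i t)) \<and>
      (\<forall>i<2. \<forall>k>0. \<forall>s t. length s = k \<and> length t = k \<and> s ! (k - 1) = t ! (k - 1) \<longrightarrow>
         delta (m (k - 1)) (m k) (nth (g i s)) (nth (g i t)) < ereal (1 / 2 ^ (k + 1))) \<and>
      (\<forall>i<2. \<forall>k>0. \<forall>s t. length s = k \<and> length t = k \<and> s ! (k - 1) \<noteq> t ! (k - 1) \<longrightarrow>
         \<bar>delta (m (k - 1)) (m k) (nth (g i s)) (nth (g i t)) - ereal (1 / real k)\<bar>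
           < ereal (1 / 2 ^ (k + 1))) \<and>
      (\<forall>i<2. \<forall>j<2. \<forall>k>0. \<forall>s. length s = k \<longrightarrow>
         delta (m (k - 1)) (m k) (nth (g i s)) (nth (g j s)) < ereal (1 / 2 ^ (k + 1))) \<and>
      (\<forall>i<2. is_reduction E2 UNIV E2 (X i \<inter> H z) (Phi (g i))) \<and>
      saturation E2 (range (Phi (g 0))) = saturation E2 (range (Phi (g 1)))
      \<longrightarrow> (Phi (g 0) (\<lambda>_. False), Phi (g 1) (\<lambda>k. odd k)) \<notin> C)
   \<and>
   (\<forall>B0 B1 :: cantor set.
      Delta11 B0 \<and> Delta11 B1 \<and> reducible E2 UNIV E2 B0 \<and> reducible E2 UNIV E2 B1 \<and>
      saturation E2 B0 = saturation E2 B1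
      \<longrightarrow> \<not> prod_E2 B0 B1 \<subseteq> C)
   \<and>
   \<not> weak_mycielski 2 E2"
proof (intro conjI allI impI, goal_cases)
  case (4 z X m g)
  \<comment> \<open>All intervals have finite endpoints, so the conditions on extended real
    distances turn into conditions on \<open>ds\<close>.\<close>
  note h = 4[unfolded delta_eq_ds ereal_minus(1) abs_ereal.simps(1) less_ereal.simps(1)]
  note h2 = conjunct2[OF h] note h3 = conjunct2[OF h2] note h4 = conjunct2[OF h3]
  note h5 = conjunct2[OF h4] note h6 = conjunct2[OF h5] note h7 = conjunct2[OF h6]
  show ?case
  proof (rule Phi_pair_notin_C)
    show "strict_mono m" by (rule conjunct1[OF h2])
  qed (fact conjunct1[OF h3, rule_format, OF _ refl] conjunct1[OF h4, rule_format]
      conjunct1[OF h5, rule_format, OF _ _ conjI[OF _ conjI]]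
      conjunct1[OF h6, rule_format, OF _ _ conjI[OF _ conjI]] conjunct1[OF h7, rule_format])+
next
  case (5 B0 B1)
  then show ?case by (intro prod_E2_not_subset_C) simp_all
next
  case 6
  show ?case by (rule not_weak_mycielski_E2) (rule prod_E2_not_subset_C; simp)
qed (fact open_D dense_D comeager_C)+

end
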